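(* Let $k$ be a field and $n$ a non-negative integer. Let $\mathcal{C}_n$ be the convex cone generated by the Betti diagrams $\beta(I(G))$ of the edge ideals of all graphs $G$ on vertex set $[n]$. Then $$\dim \mathcal{C}_n = \begin{cases} r^2 & \text{if } n=2r,\\ r^2+r & \text{if } n=2r+1.\end{cases}$$
   Context: $[n]=\{1,\dots,n\}$ and $R=k[x_1,\dots,x_n]$ with the standard grading. Graphs are finite and simple. The edge ideal $I(G)\subseteq R$ of a graph $G$ on $[n]$ is the ideal generated by $\{x_ix_j \mid \{i,j\}\in E(G)\}$. For a finitely generated graded $R$-module $M$, $\beta_{i,d}(M)$ is the $(i,d)$ graded Betti number of $M$ (the number of generators of degree $d$ in the $i$-th module of the minimal graded free resolution of $M$), and the Betti diagram $\beta(M)=(\beta_{i,d}(M))$ is regarded as a vector in the rational vector space $V_n=\bigoplus_{d\in\mathbb{Z}}\mathbb{Q}^{n+1}$ (coordinates indexed by pairs $(i,d)$ with $0\le i\le n$, $d\in\mathbb{Z}$). The cone generated by a set of vectors is the set of all finite non-negative rational linear combinations of them. The dimension of a cone is the dimension of the smallest linear subspace containing it. *)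

theory Defs
  imports
    "HOL-Library.Poly_Mapping"
    "HOL-Library.Function_Algebras"
    "HOL-Algebra.Ideal"
    "Jordan_Normal_Form.Matrix"
begin

text \<open>
  A monomial is its exponent vector \<^typ>\<open>nat \<Rightarrow>\<^sub>0 nat\<close>, a polynomial a finitely supported map from
  monomials to coefficients, multiplied by convolution. The type allows infinitely many
  variables; the polynomials in $x_1,\dots,x_n$ are singled out by a carrier.
\<close>

type_synonym 'k poly_nat = "(nat \<Rightarrow>\<^sub>0 nat) \<Rightarrow>\<^sub>0 'k"

definition poly_ring :: "nat \<Rightarrow> 'k::field poly_nat ring" where
  "poly_ring n =
     \<lparr>carrier = {p. \<forall>m \<in> Poly_Mapping.keys p. Poly_Mapping.keys m \<subseteq> {1..n}},
      monoid.mult = (*), one = 1, zero = 0, add = (+)\<rparr>"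

definition var :: "nat \<Rightarrow> 'k::field poly_nat" where
  "var i = Poly_Mapping.single (Poly_Mapping.single i 1) 1"

definition monom_degree :: "(nat \<Rightarrow>\<^sub>0 nat) \<Rightarrow> nat" where
  "monom_degree m = (\<Sum>i\<in>Poly_Mapping.keys m. Poly_Mapping.lookup m i)"

text \<open>The zero polynomial is homogeneous of every degree, and is the only one of negative degree.\<close>

definition homogeneous :: "'k::field poly_nat \<Rightarrow> int \<Rightarrow> bool" where
  "homogeneous p d \<longleftrightarrow> (\<forall>m \<in> Poly_Mapping.keys p. int (monom_degree m) = d)"

text \<open>A finite simple graph on the vertex set $[n]$, given by its set of edges.\<close>

definition graph_on :: "nat \<Rightarrow> nat set set \<Rightarrow> bool" where
  "graph_on n E \<longleftrightarrow> (\<forall>e\<in>E. e \<subseteq> {1..n} \<and> card e = 2)"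

definition edge_ideal :: "nat \<Rightarrow> nat set set \<Rightarrow> 'k::field poly_nat set" where
  "edge_ideal n E = Idl\<^bsub>poly_ring n\<^esub> {var i * var j | i j. {i, j} \<in> E}"

definition free_module :: "nat \<Rightarrow> nat \<Rightarrow> 'k::field poly_nat vec set" where
  "free_module n b = {v \<in> carrier_vec b. \<forall>j<b. v $ j \<in> carrier (poly_ring n)}"

text \<open>
  The list \<open>a\<close> of degrees stands for the graded free module $\bigoplus_j R(-a_j)$, whose $j$-th basis
  element has degree $a_j$. A degree-preserving $R$-linear map from the module of \<open>a\<close> to that
  of \<open>b\<close> is a matrix whose $(r,c)$ entry is homogeneous of degree $a_c - b_r$.
\<close>

definition graded_map :: "nat \<Rightarrow> int list \<Rightarrow> int list \<Rightarrow> 'k::field poly_nat mat \<Rightarrow> bool" where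
  "graded_map n a b A \<longleftrightarrow>
     A \<in> carrier_mat (length b) (length a) \<and>
     (\<forall>r < length b. \<forall>c < length a.
        A $$ (r, c) \<in> carrier (poly_ring n) \<and> homogeneous (A $$ (r, c)) (a ! c - b ! r))"

text \<open>
  A graded free resolution
  $\cdots \to F_2 \to F_1 \to F_0 \to I \to 0$ of a homogeneous ideal \<open>I\<close>, regarded as a graded module:
  \<open>a i\<close> lists the degrees of the generators of $F_i$, \<open>D i\<close> is the matrix of $F_{i+1} \to F_i$,
  and the row vector \<open>g\<close> of homogeneous elements of \<open>I\<close> gives the augmentation $F_0 \to I$.
  The length is not bounded a priori; a finite resolution continues with empty lists.
\<close>

definition graded_free_resolution ::
  "nat \<Rightarrow> 'k::field poly_nat set \<Rightarrow> (nat \<Rightarrow> int list) \<Rightarrow> 'k poly_nat vec \<Rightarrow> (nat \<Rightarrow> 'k poly_nat mat) \<Rightarrow> bool"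
where
  "graded_free_resolution n I a g D \<longleftrightarrow>
     g \<in> free_module n (length (a 0)) \<and>
     (\<forall>j < length (a 0). homogeneous (g $ j) (a 0 ! j)) \<and>
     (\<forall>i. graded_map n (a (Suc i)) (a i) (D i)) \<and>
     (\<lambda>v. g \<bullet> v) ` free_module n (length (a 0)) = I \<and>
     {v \<in> free_module n (length (a 0)). g \<bullet> v = 0}
       = (\<lambda>v. D 0 *\<^sub>v v) ` free_module n (length (a 1)) \<and>
     (\<forall>i. {v \<in> free_module n (length (a (Suc i))). D i *\<^sub>v v = 0\<^sub>v (length (a i))}
       = (\<lambda>v. D (Suc i) *\<^sub>v v) ` free_module n (length (a (Suc (Suc i)))))"

text \<open>
  Minimality: the image of $F_{i+1} \to F_i$ lies in $(x_1,\dots,x_n) F_i$, i.e. no matrix entry has a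
  constant term.
\<close>

definition minimal_graded_free_resolution ::
  "nat \<Rightarrow> 'k::field poly_nat set \<Rightarrow> (nat \<Rightarrow> int list) \<Rightarrow> 'k poly_nat vec \<Rightarrow> (nat \<Rightarrow> 'k poly_nat mat) \<Rightarrow> bool"
where
  "minimal_graded_free_resolution n I a g D \<longleftrightarrow>
     graded_free_resolution n I a g D \<and>
     (\<forall>i. \<forall>r < length (a i). \<forall>c < length (a (Suc i)). Poly_Mapping.lookup (D i $$ (r, c)) 0 = 0)"

text \<open>
  Minimal graded free resolutions of a homogeneous ideal exist and are unique up to isomorphism,
  so the description is proper for every homogeneous ideal.
\<close>

definition betti :: "nat \<Rightarrow> 'k::field poly_nat set \<Rightarrow> nat \<Rightarrow> int \<Rightarrow> nat" where
  "betti n I i d =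
     (THE b. \<exists>a g D. minimal_graded_free_resolution n I a g D \<and> b = count_list (a i) d)"

text \<open>
  $V_n$ is regarded as a subspace of the rational vector space of all functions of $(i,d)$:
  coordinates with $i > n$ are set to \<open>0\<close>.
\<close>

type_synonym diagram = "nat \<times> int \<Rightarrow> rat"

definition diagram_scale :: "rat \<Rightarrow> diagram \<Rightarrow> diagram" where
  "diagram_scale c v = (\<lambda>x. c * v x)"

interpretation diagram: vector_space diagram_scale
  by unfold_locales (auto simp: diagram_scale_def fun_eq_iff algebra_simps)

definition betti_diagram :: "nat \<Rightarrow> 'k::field poly_nat set \<Rightarrow> diagram" where
  "betti_diagram n I = (\<lambda>(i, d). if i \<le> n then of_nat (betti n I i d) else 0)"

definition generated_cone :: "diagram set \<Rightarrow> diagram set" where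
  "generated_cone S =
     {(\<Sum>v\<in>T. diagram_scale (c v) v) | T c. finite T \<and> T \<subseteq> S \<and> (\<forall>v\<in>T. 0 \<le> c v)}"

definition cone_dim :: "diagram set \<Rightarrow> nat" where
  "cone_dim C = diagram.dim (diagram.span C)"

text \<open>The type argument supplies the coefficient field.\<close>

definition betti_cone :: "'k::field itself \<Rightarrow> nat \<Rightarrow> diagram set" where
  "betti_cone _ n =
     generated_cone {betti_diagram n (edge_ideal n E :: 'k poly_nat set) | E. graph_on n E}"

end

theory Submission
  imports Defs "Jordan_Normal_Form.Determinant"
begin

text \<open>
  The Betti numbers of an edge ideal are bounded by the ranks in its Taylor resolution, so
  $\beta_{i,d}(I(G)) \neq 0$ forces $d \le 2(i+1)$ and $d \le n$; and $d \ge i+2$ because degrees strictly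
  increase along a minimal resolution. There are $\sum_{d \le n} \lfloor d/2 \rfloor$ such positions. Conversely, for each
  of them there is a disjoint union of stars with $i+1$ edges on $d$ vertices. Removing an edge from it
  uncovers a vertex, hence its Taylor resolution is minimal, its Betti number at $(i,d)$ is 1, and all
  others sit at positions $(i',d') \le (i,d)$: the diagrams are triangular and span the coordinate
  subspace.
\<close>

\<comment> \<open>\<open>betti\<close> is a definite description over all minimal graded free
  resolutions, so even an upper bound needs a minimal resolution to exist and any two of them to
  have the same ranks. Existence is extracted from the Taylor resolution: finite generation of each
  new syzygy module is transferred from the matching Taylor syzygies, so that neither a Noetherian
  argument nor a bound on the length enters. The comparison is carried by matrices instead of an
  isomorphism of direct sums; its error terms vanish modulo the variables as soon as one of the two
  resolutions is minimal, and this gives uniqueness and the Taylor bound at once.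

  The necessary and the sufficient conditions on (i,d) meet for a combinatorial reason. A forest
  with i+1 edges that covers d vertices, each component having an edge, has d-i-1 components. The
  inequalities i+2 \<le> d \<le> 2(i+1) say that this number lies between 1 and i+1, which is
  exactly when such a forest exists; d \<le> n says that it fits on [n]. The cut-off at i \<le> n in
  the diagrams loses nothing, since i+2 \<le> d \<le> n.\<close>
alias lookup = Poly_Mapping.lookup
alias keys = Poly_Mapping.keys
alias single = Poly_Mapping.single

subsection \<open>Homogeneous polynomials\<close>

abbreviation polys :: "nat \<Rightarrow> 'k::field poly_nat set" where
  "polys n \<equiv> carrier (poly_ring n)"

lemma polys_iff: "p \<in> polys n \<longleftrightarrow> (\<forall>m \<in> keys p. keys m \<subseteq> {1..n})"
  by (simp add: poly_ring_def)

lemma polys_0 [simp]: "0 \<in> polys n"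
  by (simp add: polys_iff)

lemma polys_1 [simp]: "1 \<in> polys n"
  by (simp add: polys_iff)

lemma polys_single: "keys m \<subseteq> {1..n} \<Longrightarrow> single m c \<in> polys n"
  by (simp add: polys_iff)

lemma polys_add: "p \<in> polys n \<Longrightarrow> q \<in> polys n \<Longrightarrow> p + q \<in> polys n"
  unfolding polys_iff using Poly_Mapping.keys_add[of p q] by blast

lemma polys_uminus: "p \<in> polys n \<Longrightarrow> - p \<in> polys n"
  unfolding polys_iff by (simp add: in_keys_iff)

lemma polys_diff: "p \<in> polys n \<Longrightarrow> q \<in> polys n \<Longrightarrow> p - q \<in> polys n"
  using polys_add[of p n "- q"] by (simp add: polys_uminus)

lemma polys_mult:
  assumes "p \<in> polys n" "q \<in> polys n"
  shows "p * q \<in> polys n"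
  unfolding polys_iff
proof
  fix m assume "m \<in> keys (p * q)"
  then obtain a b where "m = a + b" "a \<in> keys p" "b \<in> keys q"
    using keys_mult[of p q] by blast
  then show "keys m \<subseteq> {1..n}"
    using assms Poly_Mapping.keys_add[of a b] unfolding polys_iff by blast
qed

lemma polys_sum: "(\<And>x. x \<in> A \<Longrightarrow> f x \<in> polys n) \<Longrightarrow> sum f A \<in> polys n"
  by (induction A rule: infinite_finite_induct) (auto intro: polys_add)

lemma monom_degree_sum:
  assumes "finite A" "keys m \<subseteq> A"
  shows "monom_degree m = (\<Sum>i\<in>A. lookup m i)"
  unfolding monom_degree_def using assms by (intro sum.mono_neutral_left) (auto simp: in_keys_iff)

lemma monom_degree_add: "monom_degree (a + b) = monom_degree a + monom_degree b"
proof -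
  let ?A = "keys a \<union> keys b"
  have "keys (a + b) \<subseteq> ?A"
    by (rule Poly_Mapping.keys_add)
  then show ?thesis
    by (simp add: monom_degree_sum[of ?A] lookup_add sum.distrib)
qed

lemma monom_degree_0 [simp]: "monom_degree 0 = 0"
  by (simp add: monom_degree_def)

lemma monom_degree_eq_0_iff: "monom_degree m = 0 \<longleftrightarrow> m = 0"
proof
  assume "monom_degree m = 0"
  then have "lookup m i = 0" for i
    by (cases "i \<in> keys m") (auto simp: monom_degree_def in_keys_iff)
  then show "m = 0"
    by (intro poly_mapping_eqI) simp
qed simp

lemma homogeneous_0 [simp]: "homogeneous 0 d"
  by (simp add: homogeneous_def)

lemma homogeneous_1 [simp]: "homogeneous 1 0"
  by (simp add: homogeneous_def)

lemma homogeneous_single: "int (monom_degree m) = d \<Longrightarrow> homogeneous (single m c) d"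
  by (simp add: homogeneous_def)

lemma homogeneous_add: "homogeneous p d \<Longrightarrow> homogeneous q d \<Longrightarrow> homogeneous (p + q) d"
  unfolding homogeneous_def using Poly_Mapping.keys_add[of p q] by blast

lemma homogeneous_uminus: "homogeneous p d \<Longrightarrow> homogeneous (- p) d"
  unfolding homogeneous_def by (simp add: in_keys_iff)

lemma homogeneous_diff: "homogeneous p d \<Longrightarrow> homogeneous q d \<Longrightarrow> homogeneous (p - q) d"
  using homogeneous_add[of p d "- q"] by (simp add: homogeneous_uminus)

lemma homogeneous_sum: "(\<And>x. x \<in> A \<Longrightarrow> homogeneous (f x) d) \<Longrightarrow> homogeneous (sum f A) d"
  by (induction A rule: infinite_finite_induct) (auto intro: homogeneous_add)

lemma homogeneous_mult:
  assumes "homogeneous p d" "homogeneous q e"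
  shows "homogeneous (p * q) (d + e)"
  unfolding homogeneous_def
proof
  fix m assume "m \<in> keys (p * q)"
  then obtain a b where "m = a + b" "a \<in> keys p" "b \<in> keys q"
    using keys_mult[of p q] by blast
  then show "int (monom_degree m) = d + e"
    using assms unfolding homogeneous_def by (auto simp: monom_degree_add)
qed

lemma homogeneous_lookup_0:
  assumes "homogeneous p d" "lookup p 0 \<noteq> 0"
  shows "d = 0"
  using assms unfolding homogeneous_def by (metis in_keys_iff monom_degree_0 of_nat_0)

lemma homogeneous_0_eq_single:
  assumes "homogeneous p 0"
  shows "p = single 0 (lookup p 0)"
proof (rule poly_mapping_eqI)
  fix m show "lookup p m = lookup (single 0 (lookup p 0)) m"
    using assms unfolding homogeneous_def
    by (cases "m = 0") (auto simp: lookup_single monom_degree_eq_0_iff in_keys_iff when_def)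
qed

lemma homogeneous_pos:
  assumes "homogeneous p d" "p \<noteq> 0" "lookup p 0 = 0"
  shows "1 \<le> d"
proof -
  obtain m where m: "lookup p m \<noteq> 0"
    using assms(2) by (metis lookup_zero poly_mapping_eqI)
  with assms(3) have "m \<noteq> 0" by auto
  then have "monom_degree m \<noteq> 0" by (simp add: monom_degree_eq_0_iff)
  then show ?thesis
    using m assms(1) unfolding homogeneous_def by (force simp: in_keys_iff)
qed

lemma poly_mapping_induct [case_names single add]:
  fixes P :: "('a \<Rightarrow>\<^sub>0 'b::monoid_add) \<Rightarrow> bool"
  assumes single: "\<And>k v. P (single k v)"
    and add: "\<And>f g. P f \<Longrightarrow> P g \<Longrightarrow> P (f + g)"
  shows "P f"
proof (induction f rule: update_induct)
  case const
  show ?case using single[of undefined 0] by simp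
next
  case (update f a b)
  have "Poly_Mapping.update a b f = single a b + f"
    using update.hyps(1)
    by (intro poly_mapping_eqI) (auto simp: lookup_update lookup_add lookup_single in_keys_iff)
  then show ?case using update.IH single add by simp
qed

text \<open>Subtraction of exponents is truncated, so \<open>w - t\<close> is meaningful only under
  the divisibility guard; at other monomials the product has coefficient 0.\<close>

lemma lookup_single_times:
  "lookup (single t c * p) w = (if \<exists>u. w = t + u then c * lookup p (w - t) else 0)"
  for t :: "'a \<Rightarrow>\<^sub>0 nat" and p :: "('a \<Rightarrow>\<^sub>0 nat) \<Rightarrow>\<^sub>0 'k::comm_ring_1"
proof (induction p rule: poly_mapping_induct)
  case (single m d)
  show ?case
    by (auto simp: mult_single lookup_single when_def) metis
next
  case (add p q)
  then show ?case
    by (simp add: distrib_left lookup_add)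
qed

text \<open>Natural exponents add up to 0 only if both are 0. Taking constant terms is therefore
  multiplicative and serves as reduction modulo the ideal of the variables throughout the rank
  arguments.\<close>

lemma lookup_mult_0:
  "lookup (p * q) 0 = lookup p 0 * lookup q 0"
  for p q :: "('a \<Rightarrow>\<^sub>0 nat) \<Rightarrow>\<^sub>0 'k::comm_ring_1"
proof (induction p rule: poly_mapping_induct)
  case (single m d)
  have "(\<exists>u. 0 = m + u) \<longleftrightarrow> m = 0"
  proof
    assume "\<exists>u. 0 = m + u"
    then obtain u where "0 = m + u" by blast
    then have "lookup m i + lookup u i = 0" for i
      by (metis lookup_add lookup_zero)
    then show "m = 0" by (intro poly_mapping_eqI) simp
  qed auto
  then show ?case
    by (auto simp: lookup_single_times lookup_single when_def)
next
  case (add p q)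
  then show ?case
    by (simp add: distrib_right lookup_add)
qed

section \<open>Homogeneous components of polynomials\<close>

lift_definition hom_part :: "'k::field poly_nat \<Rightarrow> int \<Rightarrow> 'k poly_nat" is
  "\<lambda>p d m. if int (monom_degree m) = d then p m else 0"
  by (rule finite_subset[rotated]) auto

lemma hom_part_add: "hom_part (p + q) d = hom_part p d + hom_part q d"
  by (rule poly_mapping_eqI) (simp add: hom_part.rep_eq lookup_add)

lemma hom_part_0 [simp]: "hom_part 0 d = 0"
  by (rule poly_mapping_eqI) (simp add: hom_part.rep_eq)

lemma hom_part_sum: "hom_part (sum f A) d = (\<Sum>x\<in>A. hom_part (f x) d)"
  by (induction A rule: infinite_finite_induct) (auto simp: hom_part_add)

lemma homogeneous_hom_part: "homogeneous (hom_part p d) d"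
  by (auto simp: homogeneous_def in_keys_iff hom_part.rep_eq split: if_splits)

lemma polys_hom_part: "p \<in> polys n \<Longrightarrow> hom_part p d \<in> polys n"
  unfolding polys_iff by (metis hom_part.rep_eq in_keys_iff)

lemma hom_part_homogeneous: "homogeneous p d \<Longrightarrow> hom_part p d = p"
  by (rule poly_mapping_eqI) (auto simp: homogeneous_def in_keys_iff hom_part.rep_eq)

lemma hom_part_eq_0: "(\<And>m. m \<in> keys p \<Longrightarrow> int (monom_degree m) \<noteq> d) \<Longrightarrow> hom_part p d = 0"
  by (rule poly_mapping_eqI) (auto simp: in_keys_iff hom_part.rep_eq)

text \<open>The remainder of \<open>q\<close> after removing its component of degree
  \<open>e\<close> has no monomial of degree \<open>e\<close>, so multiplying it by \<open>p\<close>
  produces none of degree \<open>d + e\<close>.\<close>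

lemma hom_part_mult:
  assumes "homogeneous p d"
  shows "hom_part (p * q) (d + e) = p * hom_part q e"
proof -
  define r where "r = q - hom_part q e"
  have "hom_part (p * r) (d + e) = 0"
  proof (rule hom_part_eq_0)
    fix m assume "m \<in> keys (p * r)"
    then obtain a b where "m = a + b" "a \<in> keys p" "b \<in> keys r"
      using keys_mult[of p r] by blast
    moreover have "int (monom_degree b) \<noteq> e"
      using \<open>b \<in> keys r\<close> by (auto simp: r_def in_keys_iff lookup_minus hom_part.rep_eq)
    ultimately show "int (monom_degree m) \<noteq> d + e"
      using assms by (auto simp: homogeneous_def monom_degree_add)
  qed
  moreover have "p * q = p * hom_part q e + p * r"
    by (simp add: r_def algebra_simps)
  ultimately show ?thesis
    using homogeneous_mult[OF assms homogeneous_hom_part[of q e]]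
    by (simp add: hom_part_add hom_part_homogeneous)
qed

subsection \<open>Graded maps\<close>

lemma free_module_iff: "v \<in> free_module n b \<longleftrightarrow> dim_vec v = b \<and> (\<forall>j<b. v $ j \<in> polys n)"
  by (auto simp: free_module_def)

lemma free_module_carrier: "v \<in> free_module n b \<Longrightarrow> v \<in> carrier_vec b"
  by (simp add: free_module_def)

lemma free_module_add: "v \<in> free_module n b \<Longrightarrow> w \<in> free_module n b \<Longrightarrow> v + w \<in> free_module n b"
  by (auto simp: free_module_iff polys_add)

lemma free_module_zero: "0\<^sub>v b \<in> free_module n b"
  by (auto simp: free_module_iff)

lemma free_module_unit: "unit_vec b j \<in> free_module n b"
  by (auto simp: free_module_iff unit_vec_def)

lemma mult_mat_vec_nth:
  assumes "A \<in> carrier_mat r c" "v \<in> carrier_vec c" "i < r"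
  shows "(A *\<^sub>v v) $ i = (\<Sum>j<c. A $$ (i, j) * v $ j)"
  using assms by (auto simp: scalar_prod_def lessThan_atLeast0 intro!: sum.cong)

lemma mult_mat_nth:
  assumes "A \<in> carrier_mat r c" "B \<in> carrier_mat c s" "i < r" "j < s"
  shows "(A * B) $$ (i, j) = (\<Sum>k<c. A $$ (i, k) * B $$ (k, j))"
  using assms by (auto simp: scalar_prod_def lessThan_atLeast0 intro!: sum.cong)

lemma mult_mat_unit_vec:
  fixes A :: "'a::comm_ring_1 mat"
  assumes "A \<in> carrier_mat r c" "j < c"
  shows "A *\<^sub>v unit_vec c j = col A j"
proof (rule eq_vecI)
  fix i assume "i < dim_vec (col A j)"
  then have "i < r" using assms by simp
  then have "(A *\<^sub>v unit_vec c j) $ i = (\<Sum>k<c. A $$ (i, k) * unit_vec c j $ k)"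
    using assms by (intro mult_mat_vec_nth) auto
  also have "\<dots> = (\<Sum>k<c. if k = j then A $$ (i, k) else 0)"
    using assms by (intro sum.cong) auto
  finally show "(A *\<^sub>v unit_vec c j) $ i = col A j $ i"
    using assms \<open>i < r\<close> by simp
qed (use assms in auto)

lemma mult_mat_zero_vec:
  fixes A :: "'a::comm_ring_1 mat"
  assumes "A \<in> carrier_mat r c"
  shows "A *\<^sub>v 0\<^sub>v c = 0\<^sub>v r"
  using assms by (intro eq_vecI) auto

lemma graded_map_carrier: "graded_map n a b A \<Longrightarrow> A \<in> carrier_mat (length b) (length a)"
  by (simp add: graded_map_def)

lemma graded_map_homogeneous:
  "graded_map n a b A \<Longrightarrow> r < length b \<Longrightarrow> c < length a \<Longrightarrow> homogeneous (A $$ (r, c)) (a ! c - b ! r)"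
  by (simp add: graded_map_def)

lemma graded_map_mult_vec:
  assumes "graded_map n a b A" "v \<in> free_module n (length a)"
  shows "A *\<^sub>v v \<in> free_module n (length b)"
  unfolding free_module_iff
proof (intro conjI allI impI)
  fix j assume "j < length b"
  then show "(A *\<^sub>v v) $ j \<in> polys n"
    using assms mult_mat_vec_nth[OF graded_map_carrier[OF assms(1)] free_module_carrier[OF assms(2)]]
    by (auto simp: graded_map_def free_module_iff intro!: polys_sum polys_mult)
qed (use assms in \<open>auto simp: graded_map_def\<close>)

lemma graded_map_mult:
  assumes "graded_map n b c A" "graded_map n a b B"
  shows "graded_map n a c (A * B)"
  unfolding graded_map_def
proof (intro conjI allI impI)
  fix r s assume rs: "r < length c" "s < length a"
  have eq: "(A * B) $$ (r, s) = (\<Sum>k<length b. A $$ (r, k) * B $$ (k, s))"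
    using assms rs by (intro mult_mat_nth) (auto simp: graded_map_def)
  show "(A * B) $$ (r, s) \<in> polys n"
    unfolding eq using assms rs by (auto simp: graded_map_def intro!: polys_sum polys_mult)
  have "homogeneous (A $$ (r, k) * B $$ (k, s)) (a ! s - c ! r)" if "k < length b" for k
    using homogeneous_mult[OF graded_map_homogeneous[OF assms(1)] graded_map_homogeneous[OF assms(2)]]
      rs that by fastforce
  then show "homogeneous ((A * B) $$ (r, s)) (a ! s - c ! r)"
    unfolding eq by (intro homogeneous_sum) auto
qed (use assms in \<open>auto simp: graded_map_def\<close>)

lemma graded_map_minus:
  "graded_map n a b A \<Longrightarrow> graded_map n a b B \<Longrightarrow> graded_map n a b (A - B)"
  by (auto simp: graded_map_def polys_diff homogeneous_diff)

lemma graded_map_one: "graded_map n a a (1\<^sub>m (length a))"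
  by (auto simp: graded_map_def)

lemma graded_map_zero: "graded_map n a b (0\<^sub>m (length b) (length a))"
  by (auto simp: graded_map_def)

section \<open>Homogeneous components of vectors and lifting along graded maps\<close>

definition vec_hom_part :: "int list \<Rightarrow> 'k::field poly_nat vec \<Rightarrow> int \<Rightarrow> 'k poly_nat vec" where
  "vec_hom_part a v d = vec (length a) (\<lambda>j. hom_part (v $ j) (d - a ! j))"

lemma vec_hom_part_nth [simp]:
  "j < length a \<Longrightarrow> vec_hom_part a v d $ j = hom_part (v $ j) (d - a ! j)"
  by (simp add: vec_hom_part_def)

lemma dim_vec_hom_part [simp]: "dim_vec (vec_hom_part a v d) = length a"
  by (simp add: vec_hom_part_def)

lemma vec_hom_part_free_module:
  "v \<in> free_module n (length a) \<Longrightarrow> vec_hom_part a v d \<in> free_module n (length a)"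
  by (auto simp: free_module_iff polys_hom_part)

lemma graded_map_vec_hom_part:
  assumes "graded_map n a b A" "v \<in> free_module n (length a)"
  shows "A *\<^sub>v vec_hom_part a v d = vec_hom_part b (A *\<^sub>v v) d"
proof (rule eq_vecI)
  fix i assume "i < dim_vec (vec_hom_part b (A *\<^sub>v v) d)"
  then have i: "i < length b" by simp
  note A = graded_map_carrier[OF assms(1)]
  have "(A *\<^sub>v vec_hom_part a v d) $ i = (\<Sum>j<length a. A $$ (i, j) * vec_hom_part a v d $ j)"
    by (rule mult_mat_vec_nth[OF A _ i]) (simp add: carrier_vecI)
  also have "\<dots> = (\<Sum>j<length a. hom_part (A $$ (i, j) * v $ j) (d - b ! i))"
  proof (rule sum.cong)
    fix j assume "j \<in> {..<length a}"
    then show "A $$ (i, j) * vec_hom_part a v d $ j = hom_part (A $$ (i, j) * v $ j) (d - b ! i)"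
      using hom_part_mult[OF graded_map_homogeneous[OF assms(1) i], of j "v $ j" "d - a ! j"] by (simp add: algebra_simps)
  qed simp
  also have "\<dots> = hom_part ((A *\<^sub>v v) $ i) (d - b ! i)"
    using i by (subst mult_mat_vec_nth[OF A free_module_carrier[OF assms(2)]]) (auto simp: hom_part_sum)
  finally show "(A *\<^sub>v vec_hom_part a v d) $ i = vec_hom_part b (A *\<^sub>v v) d $ i"
    using i by simp
qed (use assms in \<open>auto simp: graded_map_def\<close>)

abbreviation image_of :: "nat \<Rightarrow> int list \<Rightarrow> 'k::field poly_nat mat \<Rightarrow> 'k poly_nat vec set" where
  "image_of n a A \<equiv> (\<lambda>v. A *\<^sub>v v) ` free_module n (length a)"

definition kernel_of :: "nat \<Rightarrow> int list \<Rightarrow> int list \<Rightarrow> 'k::field poly_nat mat \<Rightarrow> 'k poly_nat vec set" where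
  "kernel_of n a b A = {v \<in> free_module n (length a). A *\<^sub>v v = 0\<^sub>v (length b)}"

text \<open>Graded projectivity of free modules. Each column of \<open>A\<close> has a preimage
  under \<open>D\<close>; as the column is homogeneous and \<open>D\<close> respects components, the
  component of the preimage in the degree of that column is still a preimage, and these components
  form \<open>B\<close>.\<close>

lemma graded_lift:
  assumes D: "graded_map n a b D" and A: "graded_map n c b A"
    and im: "\<And>v. v \<in> free_module n (length c) \<Longrightarrow> A *\<^sub>v v \<in> image_of n a D"
  obtains B where "graded_map n c a B" "D * B = A"
proof -
  note DA = graded_map_carrier[OF D] graded_map_carrier[OF A]
  have "\<exists>w. w \<in> free_module n (length a) \<and> D *\<^sub>v w = col A j
      \<and> (\<forall>i<length a. homogeneous (w $ i) (c ! j - a ! i))" if j: "j < length c" for j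
  proof -
    have "col A j \<in> image_of n a D"
      using im[OF free_module_unit[of "length c" j]] mult_mat_unit_vec[OF DA(2) j] by simp
    then obtain v where v: "v \<in> free_module n (length a)" "D *\<^sub>v v = col A j"
      by auto
    have "vec_hom_part b (col A j) (c ! j) = col A j"
      using A j DA(2) by (intro eq_vecI) (auto simp: hom_part_homogeneous graded_map_def)
    then show ?thesis
      using graded_map_vec_hom_part[OF D v(1), of "c ! j"] v
      by (intro exI[of _ "vec_hom_part a v (c ! j)"])
        (auto simp: vec_hom_part_free_module homogeneous_hom_part)
  qed
  then obtain w where w: "\<And>j. j < length c \<Longrightarrow> w j \<in> free_module n (length a)"
    "\<And>j. j < length c \<Longrightarrow> D *\<^sub>v w j = col A j"
    "\<And>j i. j < length c \<Longrightarrow> i < length a \<Longrightarrow> homogeneous (w j $ i) (c ! j - a ! i)"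
    by metis
  define B where "B = mat (length a) (length c) (\<lambda>(i, j). w j $ i)"
  have B: "graded_map n c a B"
    using w(1,3) by (auto simp: graded_map_def B_def free_module_iff)
  have "col B j = w j" if "j < length c" for j
    using w(1)[OF that] that by (intro eq_vecI) (auto simp: B_def free_module_iff)
  then have "D * B = A"
    using DA graded_map_carrier[OF B] w(2) by (intro mat_col_eqI) (auto simp: col_mult2)
  with B that show ?thesis by blast
qed

subsection \<open>Stable equivalence of submodules\<close>

text \<open>
  A substitute for Schanuel's lemma: maps \<open>\<Phi>\<close>, \<open>\<Psi>\<close> between the free modules exchange
  \<open>K\<close> and \<open>L\<close>, and on \<open>K\<close> the composite \<open>\<Psi> \<Phi>\<close> is the identity up to a map \<open>E\<close> that extends to the whole
  free module with values in \<open>K\<close>. This passes to the syzygy modules, and it makes \<open>K\<close> finitely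
  generated if \<open>L\<close> is.
\<close>

definition stable_equiv :: "nat \<Rightarrow> int list \<Rightarrow> 'k::field poly_nat vec set \<Rightarrow> int list \<Rightarrow> 'k poly_nat vec set \<Rightarrow>
    'k poly_nat mat \<Rightarrow> 'k poly_nat mat \<Rightarrow> 'k poly_nat mat \<Rightarrow> bool" where
  "stable_equiv n a K b L \<Phi> \<Psi> E \<longleftrightarrow>
     graded_map n a b \<Phi> \<and> graded_map n b a \<Psi> \<and> graded_map n a a E \<and>
     K \<subseteq> free_module n (length a) \<and> L \<subseteq> free_module n (length b) \<and>
     (\<forall>v\<in>K. \<Phi> *\<^sub>v v \<in> L) \<and> (\<forall>w\<in>L. \<Psi> *\<^sub>v w \<in> K) \<and>
     (\<forall>v\<in>free_module n (length a). E *\<^sub>v v \<in> K) \<and>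
     (\<forall>v\<in>K. E *\<^sub>v v = \<Psi> *\<^sub>v (\<Phi> *\<^sub>v v) - v)"

text \<open>\<Phi>' and \<Psi>' lift \<open>\<Phi> * D\<close> and \<open>\<Psi> * C\<close>. Since
  \<open>E\<close> maps the whole free module into \<open>K\<close>, the image of \<open>D\<close>,
  it lifts to \<open>H\<close>; this is why \<open>E\<close> is required to be defined beyond
  \<open>K\<close>. The new error \<open>\<Psi>' * \<Phi>' - 1 - H * D\<close> is killed by
  \<open>D\<close>, because \<open>D\<close> turns it into \<Psi>\<Phi> - 1 - E on \<open>K\<close>,
  which is 0; on the kernel of \<open>D\<close> the term \<open>H * D\<close> drops out. The last
  conclusion is kept for the rank comparison.\<close>

lemma stable_equiv_kernel:
  fixes K :: "'k::field poly_nat vec set"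
  assumes rel: "stable_equiv n a K b L \<Phi> \<Psi> E"
    and D: "graded_map n a' a D" "image_of n a' D = K"
    and C: "graded_map n b' b C" "image_of n b' C = L"
  obtains \<Phi>' \<Psi>' E' H where
    "stable_equiv n a' (kernel_of n a' a D) b' (kernel_of n b' b C) \<Phi>' \<Psi>' E'"
    "graded_map n a a' H" "\<Psi>' * \<Phi>' = 1\<^sub>m (length a') + E' + H * D"
proof -
  note r = rel[unfolded stable_equiv_def]
  have \<Phi>: "graded_map n a b \<Phi>" and \<Psi>: "graded_map n b a \<Psi>" and E: "graded_map n a a E"
    using r by auto
  have c: "\<Phi> \<in> carrier_mat (length b) (length a)" "\<Psi> \<in> carrier_mat (length a) (length b)"
    "E \<in> carrier_mat (length a) (length a)" "D \<in> carrier_mat (length a) (length a')"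
    "C \<in> carrier_mat (length b) (length b')"
    using \<Phi> \<Psi> E D C by (auto dest: graded_map_carrier)
  note fc = free_module_carrier
  note as = assoc_mult_mat_vec
  obtain \<Phi>' where \<Phi>': "graded_map n a' b' \<Phi>'" "C * \<Phi>' = \<Phi> * D"
  proof (rule graded_lift[OF C(1) graded_map_mult[OF \<Phi> D(1)]])
    fix v :: "'k poly_nat vec" assume v: "v \<in> free_module n (length a')"
    then have "D *\<^sub>v v \<in> K" using D(2) by blast
    then show "\<Phi> * D *\<^sub>v v \<in> image_of n b' C"
      unfolding C(2) using r as[OF c(1) c(4) fc[OF v]] by simp
  qed
  obtain \<Psi>' where \<Psi>': "graded_map n b' a' \<Psi>'" "D * \<Psi>' = \<Psi> * C"
  proof (rule graded_lift[OF D(1) graded_map_mult[OF \<Psi> C(1)]])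
    fix v :: "'k poly_nat vec" assume v: "v \<in> free_module n (length b')"
    then have "C *\<^sub>v v \<in> L" using C(2) by blast
    then show "\<Psi> * C *\<^sub>v v \<in> image_of n a' D"
      unfolding D(2) using r as[OF c(2) c(5) fc[OF v]] by simp
  qed
  obtain H where H: "graded_map n a a' H" "D * H = E"
    by (rule graded_lift[OF D(1) E]) (use r D(2) in auto)
  define E' where "E' = \<Psi>' * \<Phi>' - 1\<^sub>m (length a') - H * D"
  have c': "\<Phi>' \<in> carrier_mat (length b') (length a')" "\<Psi>' \<in> carrier_mat (length a') (length b')"
    "H \<in> carrier_mat (length a') (length a)"
    using \<Phi>' \<Psi>' H by (auto dest: graded_map_carrier)
  have E': "graded_map n a' a' E'"
    unfolding E'_def using \<Phi>' \<Psi>' H D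
    by (intro graded_map_minus graded_map_mult graded_map_one)
  have E'_mult: "E' *\<^sub>v v = \<Psi>' *\<^sub>v (\<Phi>' *\<^sub>v v) - v - H *\<^sub>v (D *\<^sub>v v)"
    if v: "v \<in> carrier_vec (length a')" for v
  proof -
    have "E' *\<^sub>v v = (\<Psi>' * \<Phi>' - 1\<^sub>m (length a')) *\<^sub>v v - H * D *\<^sub>v v"
      unfolding E'_def
      by (rule minus_mult_distrib_mat_vec) (use c c' v in auto)
    also have "(\<Psi>' * \<Phi>' - 1\<^sub>m (length a')) *\<^sub>v v = \<Psi>' * \<Phi>' *\<^sub>v v - 1\<^sub>m (length a') *\<^sub>v v"
      by (rule minus_mult_distrib_mat_vec) (use c c' v in auto)
    finally show ?thesis
      using as[OF c'(2,1) v] as[OF c'(3) c(4) v] v by simp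
  qed
  have C\<Phi>': "C *\<^sub>v (\<Phi>' *\<^sub>v v) = \<Phi> *\<^sub>v (D *\<^sub>v v)" if v: "v \<in> carrier_vec (length a')" for v
    using as[OF c(5) c'(1) v] as[OF c(1) c(4) v] \<Phi>'(2) by simp
  have D\<Psi>': "D *\<^sub>v (\<Psi>' *\<^sub>v v) = \<Psi> *\<^sub>v (C *\<^sub>v v)" if v: "v \<in> carrier_vec (length b')" for v
    using as[OF c(4) c'(2) v] as[OF c(2) c(5) v] \<Psi>'(2) by simp
  have DH: "D *\<^sub>v (H *\<^sub>v v) = E *\<^sub>v v" if v: "v \<in> carrier_vec (length a)" for v
    using as[OF c(4) c'(3) v] H(2) by simp
  note zero = mult_mat_zero_vec
  have "stable_equiv n a' (kernel_of n a' a D) b' (kernel_of n b' b C) \<Phi>' \<Psi>' E'"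
    unfolding stable_equiv_def
  proof (intro conjI ballI)
    fix v :: "'k poly_nat vec" assume v: "v \<in> free_module n (length a')"
    have "D *\<^sub>v v \<in> K" using v D(2) by blast
    then have E: "E *\<^sub>v (D *\<^sub>v v) = \<Psi> *\<^sub>v (\<Phi> *\<^sub>v (D *\<^sub>v v)) - D *\<^sub>v v"
      using r by blast
    have cv: "v \<in> carrier_vec (length a')" "D *\<^sub>v v \<in> carrier_vec (length a)"
      using fc[OF v] c by auto
    have cv': "\<Phi>' *\<^sub>v v \<in> carrier_vec (length b')" "\<Psi>' *\<^sub>v (\<Phi>' *\<^sub>v v) \<in> carrier_vec (length a')"
      "H *\<^sub>v (D *\<^sub>v v) \<in> carrier_vec (length a')" "\<Psi> *\<^sub>v (\<Phi> *\<^sub>v (D *\<^sub>v v)) \<in> carrier_vec (length a)"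
      using c c' cv by auto
    have "D *\<^sub>v (E' *\<^sub>v v) = D *\<^sub>v (\<Psi>' *\<^sub>v (\<Phi>' *\<^sub>v v)) - D *\<^sub>v v - D *\<^sub>v (H *\<^sub>v (D *\<^sub>v v))"
      unfolding E'_mult[OF cv(1)] using cv cv' c
      by (subst mult_minus_distrib_mat_vec[OF c(4)], simp, simp)+ simp
    also have "\<dots> = 0\<^sub>v (length a)"
      unfolding DH[OF cv(2)] E D\<Psi>'[OF cv'(1)] C\<Phi>'[OF cv(1)]
      by (rule minus_cancel_vec) (intro minus_carrier_vec cv cv')
    finally show "E' *\<^sub>v v \<in> kernel_of n a' a D"
      using graded_map_mult_vec[OF E' v] by (simp add: kernel_of_def)
  next
    fix v assume "v \<in> kernel_of n a' a D"
    then have v: "v \<in> free_module n (length a')" "D *\<^sub>v v = 0\<^sub>v (length a)"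
      by (auto simp: kernel_of_def)
    show "\<Phi>' *\<^sub>v v \<in> kernel_of n b' b C"
      unfolding kernel_of_def
      using graded_map_mult_vec[OF \<Phi>'(1) v(1)] C\<Phi>'[OF fc[OF v(1)]] v(2) zero[OF c(1)] by simp
    show "E' *\<^sub>v v = \<Psi>' *\<^sub>v (\<Phi>' *\<^sub>v v) - v"
      using E'_mult[OF fc[OF v(1)]] v(2) zero[OF c'(3)] c' fc[OF v(1)]
      by (auto intro!: eq_vecI)
  next
    fix v assume "v \<in> kernel_of n b' b C"
    then have v: "v \<in> free_module n (length b')" "C *\<^sub>v v = 0\<^sub>v (length b)"
      by (auto simp: kernel_of_def)
    show "\<Psi>' *\<^sub>v v \<in> kernel_of n a' a D"
      unfolding kernel_of_def
      using graded_map_mult_vec[OF \<Psi>'(1) v(1)] D\<Psi>'[OF fc[OF v(1)]] v(2) zero[OF c(2)] by simp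
  qed (use \<Phi>' \<Psi>' E' in \<open>auto simp: kernel_of_def\<close>)
  moreover have "\<Psi>' * \<Phi>' = 1\<^sub>m (length a') + E' + H * D"
    unfolding E'_def using c c' by (intro eq_matI) auto
  ultimately show ?thesis
    using that H(1) by blast
qed

text \<open>The vectors with coordinates \<open>\<gamma> r x\<close> are homogeneous generators of
  degree \<open>\<delta> x\<close>. The index type is arbitrary so that two families can be joined
  by a disjoint sum and one generator deleted by set difference, with no renumbering.\<close>

definition generates :: "nat \<Rightarrow> int list \<Rightarrow> 'k::field poly_nat vec set \<Rightarrow> 'x set \<Rightarrow> ('x \<Rightarrow> int) \<Rightarrow>
    (nat \<Rightarrow> 'x \<Rightarrow> 'k poly_nat) \<Rightarrow> bool" where
  "generates n a K X \<delta> \<gamma> \<longleftrightarrow> finite X \<and>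
     (\<forall>x\<in>X. \<forall>r<length a. \<gamma> r x \<in> polys n \<and> homogeneous (\<gamma> r x) (\<delta> x - a ! r)) \<and>
     K = {vec (length a) (\<lambda>r. \<Sum>x\<in>X. \<gamma> r x * f x) | f. \<forall>x\<in>X. f x \<in> polys n}"

definition family_mat :: "nat \<Rightarrow> 'x list \<Rightarrow> (nat \<Rightarrow> 'x \<Rightarrow> 'k) \<Rightarrow> 'k mat" where
  "family_mat m xs \<gamma> = mat m (length xs) (\<lambda>(r, j). \<gamma> r (xs ! j))"

lemma family_mat_mult:
  fixes \<gamma> :: "nat \<Rightarrow> 'x \<Rightarrow> 'a::comm_ring_1"
  assumes "distinct xs" "dim_vec v = length xs" "\<And>j. j < length xs \<Longrightarrow> v $ j = f (xs ! j)"
  shows "family_mat m xs \<gamma> *\<^sub>v v = vec m (\<lambda>r. \<Sum>x\<in>set xs. \<gamma> r x * f x)"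
proof (rule eq_vecI)
  fix r assume "r < dim_vec (vec m (\<lambda>r. \<Sum>x\<in>set xs. \<gamma> r x * f x))"
  then have r: "r < m" by simp
  have "(family_mat m xs \<gamma> *\<^sub>v v) $ r = (\<Sum>j<length xs. family_mat m xs \<gamma> $$ (r, j) * v $ j)"
    by (rule mult_mat_vec_nth[OF _ _ r]) (use assms(2) in \<open>auto simp: family_mat_def intro: carrier_vecI\<close>)
  also have "\<dots> = (\<Sum>j<length xs. \<gamma> r (xs ! j) * f (xs ! j))"
    using r assms by (intro sum.cong) (auto simp: family_mat_def)
  also have "\<dots> = (\<Sum>x\<in>set xs. \<gamma> r x * f x)"
    using assms(1) by (intro sum.reindex_bij_betw[of "(!) xs"] bij_betw_nth) auto
  finally show "(family_mat m xs \<gamma> *\<^sub>v v) $ r = vec m (\<lambda>r. \<Sum>x\<in>set xs. \<gamma> r x * f x) $ r"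
    using r by simp
qed (simp add: family_mat_def)

lemma free_module_as_family:
  assumes "distinct xs" "v \<in> free_module n (length xs)"
  obtains f where "\<And>x. x \<in> set xs \<Longrightarrow> f x \<in> polys n" "\<And>j. j < length xs \<Longrightarrow> v $ j = f (xs ! j)"
proof
  let ?f = "\<lambda>x. v $ (the_inv_into {..<length xs} ((!) xs) x)"
  have "the_inv_into {..<length xs} ((!) xs) (xs ! j) = j" if "j < length xs" for j
    using that assms(1) by (intro the_inv_into_f_f) (auto simp: inj_on_nth)
  then show *: "\<And>j. j < length xs \<Longrightarrow> v $ j = ?f (xs ! j)" by simp
  show "?f x \<in> polys n" if "x \<in> set xs" for x
    using that * assms(2) by (metis in_set_conv_nth free_module_iff)
qed

lemma generates_family_mat:
  assumes "generates n a K X \<delta> \<gamma>" "distinct xs" "set xs = X"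
  shows "graded_map n (map \<delta> xs) a (family_mat (length a) xs \<gamma>)"
    and "image_of n (map \<delta> xs) (family_mat (length a) xs \<gamma>) = K"
proof -
  let ?D = "family_mat (length a) xs \<gamma>"
  show "graded_map n (map \<delta> xs) a ?D"
    using assms(1) unfolding graded_map_def generates_def assms(3)[symmetric]
    by (auto simp: family_mat_def)
  show "image_of n (map \<delta> xs) ?D = K"
  proof (intro equalityI subsetI)
    fix v assume "v \<in> image_of n (map \<delta> xs) ?D"
    then obtain w where w: "w \<in> free_module n (length xs)" "v = ?D *\<^sub>v w" by auto
    obtain f where f: "\<And>x. x \<in> set xs \<Longrightarrow> f x \<in> polys n" "\<And>j. j < length xs \<Longrightarrow> w $ j = f (xs ! j)"
      by (rule free_module_as_family[OF assms(2) w(1)]) blast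
    have "v = vec (length a) (\<lambda>r. \<Sum>x\<in>X. \<gamma> r x * f x)"
      using family_mat_mult[OF assms(2) _ f(2)] w assms(3) by (auto simp: free_module_iff)
    with f(1) show "v \<in> K"
      using assms unfolding generates_def by blast
  next
    fix v assume "v \<in> K"
    then obtain f where f: "\<forall>x\<in>X. f x \<in> polys n" "v = vec (length a) (\<lambda>r. \<Sum>x\<in>X. \<gamma> r x * f x)"
      using assms(1) unfolding generates_def by blast
    let ?w = "vec (length xs) (\<lambda>j. f (xs ! j))"
    have "?D *\<^sub>v ?w = v"
      unfolding f(2) using assms(3) by (subst family_mat_mult[OF assms(2), of _ f]) auto
    moreover have "?w \<in> free_module n (length (map \<delta> xs))"
      using f(1) assms(3) by (auto simp: free_module_iff)
    ultimately show "v \<in> image_of n (map \<delta> xs) ?D" by (metis image_eqI)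
  qed
qed

text \<open>For v in \<open>K\<close> the vector \<Phi> v lies in \<open>L\<close>, so it equals C w
  for some w, and v = \<Psi>(C w) - E v. Hence the columns of \<open>\<Psi> * C\<close> together
  with those of \<open>E\<close> generate \<open>K\<close>: finite generation is inherited from
  \<open>L\<close>.\<close>

lemma stable_equiv_generates:
  assumes rel: "stable_equiv n a K b L \<Phi> \<Psi> E"
    and C: "graded_map n b' b C" "image_of n b' C = L"
    and add: "\<And>v w. v \<in> K \<Longrightarrow> w \<in> K \<Longrightarrow> v + w \<in> K"
  obtains X :: "(nat + nat) set" and \<delta> \<gamma> where "generates n a K X \<delta> \<gamma>"
proof -
  note r = rel[unfolded stable_equiv_def]
  have \<Phi>: "graded_map n a b \<Phi>" and \<Psi>: "graded_map n b a \<Psi>" and E: "graded_map n a a E"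
    using r by auto
  have c: "\<Phi> \<in> carrier_mat (length b) (length a)" "\<Psi> \<in> carrier_mat (length a) (length b)"
    "E \<in> carrier_mat (length a) (length a)"
    "C \<in> carrier_mat (length b) (length b')"
    using \<Phi> \<Psi> E C by (auto dest: graded_map_carrier)
  note fc = free_module_carrier
  have \<Psi>C: "graded_map n b' a (\<Psi> * C)"
    by (rule graded_map_mult[OF \<Psi> C(1)])
  define X where "X = {..<length b'} <+> {..<length a}"
  define \<delta> where "\<delta> = case_sum ((!) b') ((!) a)"
  define \<gamma> where "\<gamma> = (\<lambda>r. case_sum (\<lambda>j. (\<Psi> * C) $$ (r, j)) (\<lambda>j. E $$ (r, j)))"
  have comb: "vec (length a) (\<lambda>r. \<Sum>x\<in>X. \<gamma> r x * f x)
      = (\<Psi> * C) *\<^sub>v vec (length b') (f \<circ> Inl) + E *\<^sub>v vec (length a) (f \<circ> Inr)" for f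
  proof (rule eq_vecI)
    fix i
    assume "i < dim_vec ((\<Psi> * C) *\<^sub>v vec (length b') (f \<circ> Inl) + E *\<^sub>v vec (length a) (f \<circ> Inr))"
    then have i: "i < length a" using c by simp
    have "(\<Sum>x\<in>X. \<gamma> i x * f x)
        = (\<Sum>j<length b'. (\<Psi> * C) $$ (i, j) * vec (length b') (f \<circ> Inl) $ j)
          + (\<Sum>j<length a. E $$ (i, j) * vec (length a) (f \<circ> Inr) $ j)"
      unfolding X_def by (subst sum.Plus) (auto simp: \<gamma>_def intro!: sum.cong arg_cong2[of _ _ _ _ "(+)"])
    also have "\<dots> = ((\<Psi> * C) *\<^sub>v vec (length b') (f \<circ> Inl)) $ i + (E *\<^sub>v vec (length a) (f \<circ> Inr)) $ i"
      by (subst (1 2) mult_mat_vec_nth[OF _ _ i]) (use c in auto)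
    finally show "vec (length a) (\<lambda>r. \<Sum>x\<in>X. \<gamma> r x * f x) $ i
      = ((\<Psi> * C) *\<^sub>v vec (length b') (f \<circ> Inl) + E *\<^sub>v vec (length a) (f \<circ> Inr)) $ i"
      using i c by simp
  qed (use c in simp)
  have "K = {vec (length a) (\<lambda>r. \<Sum>x\<in>X. \<gamma> r x * f x) | f. \<forall>x\<in>X. f x \<in> polys n}"
  proof (intro equalityI subsetI)
    fix v assume v: "v \<in> K"
    then have "\<Phi> *\<^sub>v v \<in> image_of n b' C" using r C(2) by blast
    then obtain w where w: "w \<in> free_module n (length b')" "\<Phi> *\<^sub>v v = C *\<^sub>v w" by auto
    have vf: "v \<in> free_module n (length a)" using v r by blast
    define f where "f = case_sum (\<lambda>j. w $ j) (\<lambda>j. - v $ j)"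
    have "E *\<^sub>v v = \<Psi> *\<^sub>v (C *\<^sub>v w) - v" using r v w(2) by metis
    also have "\<Psi> *\<^sub>v (C *\<^sub>v w) = (\<Psi> * C) *\<^sub>v w"
      using assoc_mult_mat_vec[OF c(2,4) fc[OF w(1)]] by simp
    finally have Ev: "E *\<^sub>v v = (\<Psi> * C) *\<^sub>v w - v" .
    have "E *\<^sub>v (- v) = - (E *\<^sub>v v)"
      using c fc[OF vf] by (intro eq_vecI) auto
    then have "v = (\<Psi> * C) *\<^sub>v w + E *\<^sub>v (- v)"
      unfolding Ev using c fc[OF vf] fc[OF w(1)] by (intro eq_vecI) auto
    also have "w = vec (length b') (f \<circ> Inl)"
      using w(1) by (intro eq_vecI) (auto simp: f_def free_module_iff)
    also have "- v = vec (length a) (f \<circ> Inr)"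
      using vf by (intro eq_vecI) (auto simp: f_def free_module_iff)
    finally have "v = vec (length a) (\<lambda>r. \<Sum>x\<in>X. \<gamma> r x * f x)"
      unfolding comb .
    moreover have "\<forall>x\<in>X. f x \<in> polys n"
      using w(1) vf by (auto simp: X_def f_def free_module_iff polys_uminus)
    ultimately show "v \<in> {vec (length a) (\<lambda>r. \<Sum>x\<in>X. \<gamma> r x * f x) | f. \<forall>x\<in>X. f x \<in> polys n}"
      by blast
  next
    fix v assume "v \<in> {vec (length a) (\<lambda>r. \<Sum>x\<in>X. \<gamma> r x * f x) | f. \<forall>x\<in>X. f x \<in> polys n}"
    then obtain f where f: "\<forall>x\<in>X. f x \<in> polys n"
      and v: "v = (\<Psi> * C) *\<^sub>v vec (length b') (f \<circ> Inl) + E *\<^sub>v vec (length a) (f \<circ> Inr)"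
      using comb by auto
    have w: "vec (length b') (f \<circ> Inl) \<in> free_module n (length b')"
      "vec (length a) (f \<circ> Inr) \<in> free_module n (length a)"
      using f by (auto simp: X_def free_module_iff)
    have "\<Psi> *\<^sub>v (C *\<^sub>v vec (length b') (f \<circ> Inl)) \<in> K"
      using r w(1) C(2) by blast
    then have "(\<Psi> * C) *\<^sub>v vec (length b') (f \<circ> Inl) \<in> K"
      using assoc_mult_mat_vec[OF c(2,4) fc[OF w(1)]] by simp
    then show "v \<in> K"
      unfolding v using r w(2) by (intro add) blast+
  qed
  then have "generates n a K X \<delta> \<gamma>"
    unfolding generates_def using \<Psi>C E
    by (auto simp: X_def \<delta>_def \<gamma>_def graded_map_def)
  then show ?thesis using that by blast
qed

subsection \<open>Minimal generators and ranks\<close>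

text \<open>A graded Nakayama argument by counting: in a family of least size, no relation can have
  a coefficient with non-zero constant term, since that coefficient would become a unit in a
  suitable homogeneous component of the relation and its generator could be dropped.\<close>

lemma generates_minimal:
  fixes K :: "'k::field poly_nat vec set" and X :: "'x set"
  assumes "generates n a K X \<delta> \<gamma>"
  obtains c D where "graded_map n c a D" "image_of n c D = K"
    "\<And>v j. v \<in> kernel_of n c a D \<Longrightarrow> j < length c \<Longrightarrow> lookup (v $ j) 0 = 0"
proof -
  have "\<exists>Y. generates n a K Y \<delta> \<gamma> \<and> (\<forall>Z. generates n a K Z \<delta> \<gamma> \<longrightarrow> card Y \<le> card Z)"
    using ex_has_least_nat[of "\<lambda>Y. generates n a K Y \<delta> \<gamma>" X card] assms by blast
  then obtain Y where Y: "generates n a K Y \<delta> \<gamma>"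
    and least: "\<And>Z. generates n a K Z \<delta> \<gamma> \<Longrightarrow> card Y \<le> card Z"
    by blast
  have fin: "finite Y"
    and \<gamma>: "\<And>x r. x \<in> Y \<Longrightarrow> r < length a \<Longrightarrow> \<gamma> r x \<in> polys n \<and> homogeneous (\<gamma> r x) (\<delta> x - a ! r)"
    and K: "K = {vec (length a) (\<lambda>r. \<Sum>x\<in>Y. \<gamma> r x * f x) | f. \<forall>x\<in>Y. f x \<in> polys n}"
    using Y unfolding generates_def by auto
  obtain xs where xs: "set xs = Y" "distinct xs"
    using finite_distinct_list[OF fin] by blast
  define c where "c = map \<delta> xs"
  define D where "D = family_mat (length a) xs \<gamma>"
  have D: "graded_map n c a D" "image_of n c D = K"
    unfolding c_def D_def by (rule generates_family_mat[OF Y xs(2) xs(1)])+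
  have "lookup (v $ j) 0 = 0" if v: "v \<in> kernel_of n c a D" and j: "j < length c" for v j
  proof (rule ccontr)
    assume u: "lookup (v $ j) 0 \<noteq> 0"
    define u where "u = lookup (v $ j) 0"
    \<comment> \<open>The component of the relation in the degree of the \<open>j\<close>-th
      generator is again a relation, and its \<open>j\<close>-th coefficient is the non-zero
      constant \<open>u\<close>.\<close>
    define w where "w = vec_hom_part c v (c ! j)"
    have vf: "v \<in> free_module n (length c)" "D *\<^sub>v v = 0\<^sub>v (length a)"
      using v by (auto simp: kernel_of_def)
    have w: "w \<in> free_module n (length c)"
      unfolding w_def by (rule vec_hom_part_free_module[OF vf(1)])
    have Dw: "D *\<^sub>v w = 0\<^sub>v (length a)"
      unfolding w_def graded_map_vec_hom_part[OF D(1) vf(1)] vf(2) by (intro eq_vecI) auto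
    have wj: "w $ j = single 0 u"
    proof -
      have "w $ j = hom_part (v $ j) 0" using j by (simp add: w_def)
      also have "\<dots> = single 0 (lookup (hom_part (v $ j) 0) 0)"
        by (rule homogeneous_0_eq_single[OF homogeneous_hom_part])
      finally show ?thesis by (simp add: hom_part.rep_eq u_def)
    qed
    have len: "length c = length xs" by (simp add: c_def)
    obtain f where f: "\<And>x. x \<in> set xs \<Longrightarrow> f x \<in> polys n" "\<And>j. j < length xs \<Longrightarrow> w $ j = f (xs ! j)"
      by (rule free_module_as_family[OF xs(2) w[unfolded len]]) blast
    define x where "x = xs ! j"
    have x: "x \<in> Y" using j xs(1) by (auto simp: x_def len)
    have fx: "f x = single 0 u" using f(2)[of j] j wj by (simp add: x_def len)
    define t :: "'k poly_nat" where "t = single 0 (inverse u)"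
    have tu: "t * single 0 u = 1" using u by (simp add: t_def mult_single u_def)
    have t: "t \<in> polys n" by (simp add: t_def polys_single)
    have rel: "(\<Sum>y\<in>Y. \<gamma> r y * f y) = 0" if "r < length a" for r
    proof -
      have "dim_vec w = length xs" using w by (simp add: free_module_iff len)
      then have "D *\<^sub>v w = vec (length a) (\<lambda>r. \<Sum>y\<in>Y. \<gamma> r y * f y)"
        unfolding D_def xs(1)[symmetric] by (rule family_mat_mult[OF xs(2) _ f(2)])
      then have "(D *\<^sub>v w) $ r = (\<Sum>y\<in>Y. \<gamma> r y * f y)" using that by simp
      with Dw that show ?thesis by simp
    qed
    have x_eq: "\<gamma> r x = - (\<Sum>y\<in>Y - {x}. \<gamma> r y * (f y * t))" if "r < length a" for r
    proof -
      have "\<gamma> r x * f x = - (\<Sum>y\<in>Y - {x}. \<gamma> r y * f y)"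
        using rel[OF that] fin x by (simp add: sum.remove add_eq_0_iff2)
      then have "\<gamma> r x * (f x * t) = - (\<Sum>y\<in>Y - {x}. \<gamma> r y * (f y * t))"
        by (simp add: mult.assoc[symmetric] sum_distrib_right)
      then show ?thesis using tu fx by (simp add: mult.commute)
    qed
    have "generates n a K (Y - {x}) \<delta> \<gamma>"
      unfolding generates_def
    proof (intro conjI)
      show "K = {vec (length a) (\<lambda>r. \<Sum>y\<in>Y - {x}. \<gamma> r y * f y) |f. \<forall>y\<in>Y - {x}. f y \<in> polys n}"
      proof (intro equalityI subsetI)
        fix v assume "v \<in> K"
        then obtain h where h: "\<forall>y\<in>Y. h y \<in> polys n" "v = vec (length a) (\<lambda>r. \<Sum>y\<in>Y. \<gamma> r y * h y)"
          unfolding K by blast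
        \<comment> \<open>Substituting \<open>x_eq\<close> for the generator \<open>x\<close>
          spreads its coefficient \<open>h x\<close> over the others.\<close>
        define h' where "h' = (\<lambda>y. h y - h x * (f y * t))"
        have "(\<Sum>y\<in>Y. \<gamma> r y * h y) = (\<Sum>y\<in>Y - {x}. \<gamma> r y * h' y)" if r: "r < length a" for r
        proof -
          have "(\<Sum>y\<in>Y. \<gamma> r y * h y) = \<gamma> r x * h x + (\<Sum>y\<in>Y - {x}. \<gamma> r y * h y)"
            using fin x by (simp add: sum.remove)
          also have "\<dots> = (\<Sum>y\<in>Y - {x}. \<gamma> r y * h y) - h x * (\<Sum>y\<in>Y - {x}. \<gamma> r y * (f y * t))"
            unfolding x_eq[OF r] by (simp add: algebra_simps)
          also have "\<dots> = (\<Sum>y\<in>Y - {x}. \<gamma> r y * h' y)"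
            unfolding sum_distrib_left sum_subtractf[symmetric] h'_def
            by (intro sum.cong) (auto simp: algebra_simps)
          finally show ?thesis .
        qed
        then have "v = vec (length a) (\<lambda>r. \<Sum>y\<in>Y - {x}. \<gamma> r y * h' y)"
          unfolding h(2) by (intro eq_vecI) auto
        moreover have "\<forall>y\<in>Y - {x}. h' y \<in> polys n"
          using h(1) f(1) t x xs(1) by (auto simp: h'_def intro!: polys_diff polys_mult)
        ultimately show "v \<in> {vec (length a) (\<lambda>r. \<Sum>y\<in>Y - {x}. \<gamma> r y * f y) |f. \<forall>y\<in>Y - {x}. f y \<in> polys n}"
          by blast
      next
        fix v assume "v \<in> {vec (length a) (\<lambda>r. \<Sum>y\<in>Y - {x}. \<gamma> r y * f y) |f. \<forall>y\<in>Y - {x}. f y \<in> polys n}"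
        then obtain h where h: "\<forall>y\<in>Y - {x}. h y \<in> polys n"
          "v = vec (length a) (\<lambda>r. \<Sum>y\<in>Y - {x}. \<gamma> r y * h y)"
          by blast
        let ?h = "h(x := 0)"
        have "(\<Sum>y\<in>Y. \<gamma> r y * ?h y) = (\<Sum>y\<in>Y - {x}. \<gamma> r y * h y)" for r
        proof -
          have "(\<Sum>y\<in>Y. \<gamma> r y * ?h y) = (\<Sum>y\<in>Y - {x}. \<gamma> r y * ?h y)"
            using fin x by (subst sum.remove[of _ x]) auto
          then show ?thesis by simp
        qed
        then have "v = vec (length a) (\<lambda>r. \<Sum>y\<in>Y. \<gamma> r y * ?h y)"
          using h(2) by simp
        moreover have "\<forall>y\<in>Y. ?h y \<in> polys n" using h(1) by auto
        ultimately show "v \<in> K" unfolding K by blast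
      qed
    qed (use fin \<gamma> in auto)
    then have "card Y \<le> card (Y - {x})" by (rule least)
    then show False using fin x by (metis card_Diff1_less linorder_not_le)
  qed
  with D that show ?thesis by blast
qed

text \<open>If q < p, padding both matrices with zeros to size p by p keeps the product
  \<open>A * B\<close>. A one-sided inverse of a square matrix is two-sided, yet row q of the padded
  \<open>B'\<close> is zero.\<close>

lemma left_inverse_dim_le:
  fixes A B :: "'a::field mat"
  assumes A: "A \<in> carrier_mat p q" and B: "B \<in> carrier_mat q p" and AB: "A * B = 1\<^sub>m p"
  shows "p \<le> q"
proof (rule ccontr)
  assume "\<not> p \<le> q"
  then have q: "q < p" by simp
  define A' where "A' = mat p p (\<lambda>(i, j). if j < q then A $$ (i, j) else 0)"
  define B' where "B' = mat p p (\<lambda>(i, j). if i < q then B $$ (i, j) else 0)"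
  have c: "A' \<in> carrier_mat p p" "B' \<in> carrier_mat p p" by (auto simp: A'_def B'_def)
  have "A' * B' = 1\<^sub>m p"
  proof (rule eq_matI)
    fix i j assume "i < dim_row (1\<^sub>m p)" "j < dim_col (1\<^sub>m p)"
    then have ij: "i < p" "j < p" by auto
    have "(A' * B') $$ (i, j) = (\<Sum>k<p. A' $$ (i, k) * B' $$ (k, j))"
      by (rule mult_mat_nth[OF c ij])
    also have "\<dots> = (\<Sum>k<q. A' $$ (i, k) * B' $$ (k, j))"
      using q ij by (intro sum.mono_neutral_right) (auto simp: A'_def)
    also have "\<dots> = (\<Sum>k<q. A $$ (i, k) * B $$ (k, j))"
      using q ij by (intro sum.cong) (auto simp: A'_def B'_def)
    also have "\<dots> = (A * B) $$ (i, j)"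
      by (rule mult_mat_nth[OF A B ij, symmetric])
    finally show "(A' * B') $$ (i, j) = 1\<^sub>m p $$ (i, j)" by (simp add: AB)
  qed (use c in auto)
  then have "B' * A' = 1\<^sub>m p"
    by (rule mat_mult_left_right_inverse[OF c])
  moreover have "(B' * A') $$ (q, q) = 0"
    using q by (subst mult_mat_nth[OF c(2,1)]) (auto simp: B'_def)
  ultimately show False using q by simp
qed

text \<open>An entry of a graded map between generators of different degrees has no constant term.
  Modulo the variables the maps are thus block diagonal by degree, and the blocks of degree
  \<open>d\<close> satisfy \<open>A * B = 1\<close>.\<close>

lemma count_list_le_of_left_inverse:
  assumes M: "graded_map n a b M" and N: "graded_map n b a N"
    and NM: "\<And>i j. i < length a \<Longrightarrow> j < length a \<Longrightarrow>
      lookup ((N * M) $$ (i, j)) 0 = (if i = j then 1 else 0)"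
  shows "count_list a d \<le> count_list b d"
proof -
  define xs where "xs = filter (\<lambda>i. a ! i = d) [0..<length a]"
  define ys where "ys = filter (\<lambda>i. b ! i = d) [0..<length b]"
  have len: "length (filter (\<lambda>i. c ! i = d) [0..<length c]) = count_list c d" for c :: "int list"
    by (simp add: count_list_eq_length_filter length_filter_conv_card eq_commute[of d])
      (intro arg_cong[of _ _ card], auto)
  define A where "A = mat (length xs) (length ys) (\<lambda>(i, r). lookup (N $$ (xs ! i, ys ! r)) 0)"
  define B where "B = mat (length ys) (length xs) (\<lambda>(r, i). lookup (M $$ (ys ! r, xs ! i)) 0)"
  have c: "A \<in> carrier_mat (length xs) (length ys)" "B \<in> carrier_mat (length ys) (length xs)"
    by (auto simp: A_def B_def)
  have xs: "distinct xs" "set xs = {i. i < length a \<and> a ! i = d}"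
    and ys: "distinct ys" "set ys = {i. i < length b \<and> b ! i = d}"
    by (auto simp: xs_def ys_def)
  have "A * B = 1\<^sub>m (length xs)"
  proof (rule eq_matI)
    fix i j assume "i < dim_row (1\<^sub>m (length xs))" "j < dim_col (1\<^sub>m (length xs))"
    then have ij: "i < length xs" "j < length xs" by auto
    then have x: "xs ! i \<in> set xs" "xs ! j \<in> set xs" by auto
    let ?g = "\<lambda>k. lookup (N $$ (xs ! i, k)) 0 * lookup (M $$ (k, xs ! j)) 0"
    have "(A * B) $$ (i, j) = (\<Sum>r<length ys. ?g (ys ! r))"
      unfolding mult_mat_nth[OF c ij] using ij by (intro sum.cong) (auto simp: A_def B_def)
    also have "\<dots> = (\<Sum>k\<in>set ys. ?g k)"
      using ys(1) by (intro sum.reindex_bij_betw[of "(!) ys"] bij_betw_nth) auto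
    also have "\<dots> = (\<Sum>k<length b. ?g k)"
    proof (rule sum.mono_neutral_left)
      show "\<forall>k\<in>{..<length b} - set ys. ?g k = 0"
      proof
        fix k assume k: "k \<in> {..<length b} - set ys"
        then have kb: "k < length b" "b ! k \<noteq> d" using ys(2) by blast+
        have xj: "xs ! j < length a" "a ! (xs ! j) = d" using x(2) xs(2) by blast+
        have "lookup (M $$ (k, xs ! j)) 0 = 0"
          using homogeneous_lookup_0[OF graded_map_homogeneous[OF M kb(1) xj(1)]] kb(2) xj(2) by auto
        then show "?g k = 0" by simp
      qed
    qed (use ys in auto)
    also have "\<dots> = lookup ((N * M) $$ (xs ! i, xs ! j)) 0"
      using x xs by (subst mult_mat_nth[OF graded_map_carrier[OF N] graded_map_carrier[OF M]])
        (auto simp: lookup_sum lookup_mult_0)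
    also have "\<dots> = (if xs ! i = xs ! j then 1 else 0)"
      using x xs by (intro NM) auto
    finally show "(A * B) $$ (i, j) = 1\<^sub>m (length xs) $$ (i, j)"
      using ij xs(1) by (simp add: nth_eq_iff_index_eq)
  qed (use c in auto)
  then have "length xs \<le> length ys" by (rule left_inverse_dim_le[OF c])
  then show ?thesis by (simp add: xs_def ys_def len)
qed

subsection \<open>Resolutions\<close>

text \<open>
  A resolution of the ideal \<open>I\<close> is handled as one of $R/I$: the augmentation becomes the map \<open>M 0\<close>
  from \<open>e 1\<close> to the free module of rank one, so that all syzygy modules are treated alike, at the price
  of an index shift.
\<close>

definition resolves :: "nat \<Rightarrow> 'k::field poly_nat set \<Rightarrow> (nat \<Rightarrow> int list) \<Rightarrow> (nat \<Rightarrow> 'k poly_nat mat) \<Rightarrow> bool" where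
  "resolves n I e M \<longleftrightarrow> e 0 = [0] \<and> (\<forall>i. graded_map n (e (Suc i)) (e i) (M i)) \<and>
     image_of n (e 1) (M 0) = (\<lambda>p. vec 1 (\<lambda>_. p)) ` I \<and>
     (\<forall>i. kernel_of n (e (Suc i)) (e i) (M i) = image_of n (e (Suc (Suc i))) (M (Suc i)))"

lemma resolves_graded_map: "resolves n I e M \<Longrightarrow> graded_map n (e (Suc i)) (e i) (M i)"
  by (simp add: resolves_def)

lemma resolves_carrier:
  "resolves n I e M \<Longrightarrow> M i \<in> carrier_mat (length (e i)) (length (e (Suc i)))"
  by (rule graded_map_carrier[OF resolves_graded_map])

lemma resolves_exact:
  "resolves n I e M \<Longrightarrow> kernel_of n (e (Suc i)) (e i) (M i) = image_of n (e (Suc (Suc i))) (M (Suc i))"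
  by (simp add: resolves_def)

lemma resolves_image: "resolves n I e M \<Longrightarrow> image_of n (e 1) (M 0) = (\<lambda>p. vec 1 (\<lambda>_. p)) ` I"
  by (simp add: resolves_def)

lemma resolves_0: "resolves n I e M \<Longrightarrow> e 0 = [0]"
  by (simp add: resolves_def)

lemma stable_equiv_refl:
  assumes "K \<subseteq> free_module n (length a)" "0\<^sub>v (length a) \<in> K"
  shows "stable_equiv n a K a K (1\<^sub>m (length a)) (1\<^sub>m (length a)) (0\<^sub>m (length a) (length a))"
proof -
  have z: "0\<^sub>m (length a) (length a) *\<^sub>v v = 0\<^sub>v (length a)" "1\<^sub>m (length a) *\<^sub>v v = v"
    if "v \<in> free_module n (length a)" for v :: "'a poly_nat vec"
    using free_module_carrier[OF that] by (auto intro!: eq_vecI)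
  show ?thesis
    unfolding stable_equiv_def using assms z free_module_carrier
    by (fastforce simp: graded_map_one graded_map_zero)
qed

lemma image_of_closed_add:
  assumes "graded_map n a b A" "v \<in> image_of n a A" "w \<in> image_of n a A"
  shows "v + w \<in> image_of n a A"
proof -
  obtain x y where "x \<in> free_module n (length a)" "y \<in> free_module n (length a)" "v = A *\<^sub>v x" "w = A *\<^sub>v y"
    using assms(2,3) by blast
  then show ?thesis
    using mult_add_distrib_mat_vec[OF graded_map_carrier[OF assms(1)], of x y]
    by (metis free_module_add free_module_carrier image_eqI)
qed

lemma zero_in_image_of:
  assumes "graded_map n a b A"
  shows "0\<^sub>v (length b) \<in> image_of n a A"
  using mult_mat_zero_vec[OF graded_map_carrier[OF assms]] free_module_zero by (metis image_eqI)

lemma image_of_subset: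
  assumes "graded_map n a b A"
  shows "image_of n a A \<subseteq> free_module n (length b)"
  using graded_map_mult_vec[OF assms] by blast

lemma kernel_of_closed_add:
  assumes "graded_map n a b A" "v \<in> kernel_of n a b A" "w \<in> kernel_of n a b A"
  shows "v + w \<in> kernel_of n a b A"
  using assms mult_add_distrib_mat_vec[OF graded_map_carrier[OF assms(1)], of v w]
  by (auto simp: kernel_of_def free_module_add free_module_carrier)

text \<open>Built stage by stage next to \<open>T\<close>: a submodule stably equivalent to an image
  in \<open>T\<close> is finitely generated, hence has a minimal generating family, and the kernel
  of the resulting map is stably equivalent to the next image in \<open>T\<close>.\<close>

lemma resolves_minimal_exists:
  fixes I :: "'k::field poly_nat set"
  assumes "resolves n I t T"
  obtains e M where "resolves n I e M"
    "\<And>i v j. v \<in> kernel_of n (e (Suc i)) (e i) (M i) \<Longrightarrow> j < length (e (Suc i)) \<Longrightarrow> lookup (v $ j) 0 = 0"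
proof -
  have T: "\<And>i. graded_map n (t (Suc i)) (t i) (T i)" "t 0 = [0]"
    and exT: "\<And>i. kernel_of n (t (Suc i)) (t i) (T i) = image_of n (t (Suc (Suc i))) (T (Suc i))"
    and T0: "image_of n (t 1) (T 0) = (\<lambda>p. vec 1 (\<lambda>_. p)) ` I"
    using assms unfolding resolves_def by auto
  \<comment> \<open>In a state \<open>(a, K)\<close>, \<open>K\<close> is the submodule of the free
    module of \<open>a\<close> that the next map has to cover. Closure under addition is what
    \<open>stable_equiv_generates\<close> asks for besides the equivalence.\<close>
  define P where "P = (\<lambda>i (a, K).
    (\<exists>\<Phi> \<Psi> E. stable_equiv n a K (t i) (image_of n (t (Suc i)) (T i)) \<Phi> \<Psi> E) \<and>
    (\<forall>v\<in>K. \<forall>w\<in>K. v + w \<in> K) \<and> (i = 0 \<longrightarrow> a = [0] \<and> K = image_of n (t 1) (T 0)))"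
  define Q where "Q = (\<lambda>(i::nat) (a, K :: 'k poly_nat vec set) (a', K'). \<exists>D.
    graded_map n a' a D \<and> image_of n a' D = K \<and> K' = kernel_of n a' a D \<and>
    (\<forall>v\<in>K'. \<forall>j<length a'. lookup (v $ j) 0 = 0))"
  have "\<exists>f. \<forall>i. P i (f i) \<and> Q i (f i) (f (Suc i))"
  proof (rule dependent_nat_choice)
    have "P 0 ([0], image_of n (t 1) (T 0))"
      unfolding P_def using stable_equiv_refl[of "image_of n (t 1) (T 0)" n "[0]"]
        image_of_subset[OF T(1)[of 0]] zero_in_image_of[OF T(1)[of 0]] image_of_closed_add[OF T(1)[of 0]] T(2)
      by auto
    then show "\<exists>x. P 0 x" by blast
  next
    fix x i assume "P i x"
    obtain a K where x: "x = (a, K)" by (cases x)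
    obtain \<Phi> \<Psi> E where rel: "stable_equiv n a K (t i) (image_of n (t (Suc i)) (T i)) \<Phi> \<Psi> E"
      and add: "\<And>v w. v \<in> K \<Longrightarrow> w \<in> K \<Longrightarrow> v + w \<in> K"
      using \<open>P i x\<close> unfolding P_def x by auto
    obtain X :: "(nat + nat) set" and \<delta> \<gamma> where "generates n a K X \<delta> \<gamma>"
      by (rule stable_equiv_generates[OF rel T(1) refl add])
    then obtain c D where D: "graded_map n c a D" "image_of n c D = K"
      "\<And>v j. v \<in> kernel_of n c a D \<Longrightarrow> j < length c \<Longrightarrow> lookup (v $ j) 0 = 0"
      by (rule generates_minimal) blast
    obtain \<Phi>' \<Psi>' E' H where
      "stable_equiv n c (kernel_of n c a D) (t (Suc i)) (kernel_of n (t (Suc i)) (t i) (T i)) \<Phi>' \<Psi>' E'"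
      "graded_map n a c H" "\<Psi>' * \<Phi>' = 1\<^sub>m (length c) + E' + H * D"
      by (rule stable_equiv_kernel[OF rel D(1,2) T(1) refl])
    then have "P (Suc i) (c, kernel_of n c a D)"
      unfolding P_def exT using kernel_of_closed_add[OF D(1)] by auto
    moreover have "Q i x (c, kernel_of n c a D)"
      unfolding Q_def x using D by auto
    ultimately show "\<exists>y. P (Suc i) y \<and> Q i x y" by blast
  qed
  then obtain f where f: "\<And>i. P i (f i)" "\<And>i. Q i (f i) (f (Suc i))" by blast
  define e where "e = (\<lambda>i. fst (f i))"
  have "\<exists>D. graded_map n (e (Suc i)) (e i) D \<and> image_of n (e (Suc i)) D = snd (f i) \<and>
      snd (f (Suc i)) = kernel_of n (e (Suc i)) (e i) D \<and>
      (\<forall>v\<in>snd (f (Suc i)). \<forall>j<length (e (Suc i)). lookup (v $ j) 0 = 0)" for i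
    using f(2)[of i] unfolding Q_def e_def by (auto simp: split_beta)
  then obtain M where M: "\<And>i. graded_map n (e (Suc i)) (e i) (M i)"
    "\<And>i. image_of n (e (Suc i)) (M i) = snd (f i)"
    "\<And>i. snd (f (Suc i)) = kernel_of n (e (Suc i)) (e i) (M i)"
    "\<And>i v j. v \<in> snd (f (Suc i)) \<Longrightarrow> j < length (e (Suc i)) \<Longrightarrow> lookup (v $ j) 0 = 0"
    by metis
  have "e 0 = [0]" "snd (f 0) = image_of n (t 1) (T 0)"
    using f(1)[of 0] unfolding P_def e_def by (auto simp: split_beta)
  then have "resolves n I e M"
    unfolding resolves_def using M(1,2,3) T0 by auto
  then show ?thesis using that M(3,4) by blast
qed

text \<open>Both resolutions begin with the same submodule of the ring, namely \<open>I\<close>,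
  where identity maps serve; \<open>stable_equiv_kernel\<close> carries the equivalence
  along.\<close>

lemma resolves_stable_equiv:
  assumes "resolves n I e M" "resolves n I t T"
  shows "\<exists>\<Phi> \<Psi> E. stable_equiv n (e i) (image_of n (e (Suc i)) (M i)) (t i) (image_of n (t (Suc i)) (T i)) \<Phi> \<Psi> E"
proof (induction i)
  case 0
  have M: "graded_map n (e 1) [0] (M 0)" "e 0 = [0]" "t 0 = [0]"
    "image_of n (t 1) (T 0) = image_of n (e 1) (M 0)"
    using assms unfolding resolves_def by (metis One_nat_def)+
  then show ?case
    using stable_equiv_refl[of "image_of n (e 1) (M 0)" n "[0]"] image_of_subset[OF M(1)] zero_in_image_of[OF M(1)]
    by (metis One_nat_def)
next
  case (Suc i)
  then obtain \<Phi> \<Psi> E where rel: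
    "stable_equiv n (e i) (image_of n (e (Suc i)) (M i)) (t i) (image_of n (t (Suc i)) (T i)) \<Phi> \<Psi> E"
    by blast
  have "graded_map n (e (Suc i)) (e i) (M i)" "graded_map n (t (Suc i)) (t i) (T i)"
    "kernel_of n (e (Suc i)) (e i) (M i) = image_of n (e (Suc (Suc i))) (M (Suc i))"
    "kernel_of n (t (Suc i)) (t i) (T i) = image_of n (t (Suc (Suc i))) (T (Suc i))"
    using assms unfolding resolves_def by auto
  then show ?case
    using stable_equiv_kernel[OF rel _ refl _ refl] by metis
qed

text \<open>Minimality of a map, stated for any matrix so that it can also be asked of the
  augmentation \<open>M 0\<close>, where it says that the generators have no constant term.\<close>

definition const_free :: "'k::field poly_nat mat \<Rightarrow> bool" where
  "const_free A \<longleftrightarrow> (\<forall>i<dim_row A. \<forall>j<dim_col A. lookup (A $$ (i, j)) 0 = 0)"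

lemma const_free_mult_vec:
  assumes "const_free A" "A \<in> carrier_mat r c" "v \<in> carrier_vec c" "i < r"
  shows "lookup ((A *\<^sub>v v) $ i) 0 = 0"
  using assms by (subst mult_mat_vec_nth[OF assms(2-4)]) (auto simp: lookup_sum lookup_mult_0 const_free_def)

text \<open>In \<open>\<Psi>' * \<Phi>' = 1 + E' + H * M i\<close> both extra terms vanish modulo
  the variables: the columns of \<open>E'\<close> lie in the kernel of \<open>M i\<close>, hence in
  the image of the \<open>const_free\<close> matrix \<open>M (Suc i)\<close>, and \<open>M i\<close>
  is \<open>const_free\<close> itself. Only one resolution has to be minimal, so the lemma yields
  uniqueness when used in both directions and the bound by an arbitrary resolution when used
  once.\<close>

lemma minimal_resolution_count_le:
  assumes M: "resolves n I e M" "\<And>i. const_free (M i)" and T: "resolves n I t T"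
  shows "count_list (e (Suc i)) d \<le> count_list (t (Suc i)) d"
proof -
  obtain \<Phi> \<Psi> E where rel:
    "stable_equiv n (e i) (image_of n (e (Suc i)) (M i)) (t i) (image_of n (t (Suc i)) (T i)) \<Phi> \<Psi> E"
    using resolves_stable_equiv[OF M(1) T] by blast
  have gM: "graded_map n (e (Suc j)) (e j) (M j)" for j
    using M(1) unfolding resolves_def by blast
  have gT: "graded_map n (t (Suc i)) (t i) (T i)"
    using T unfolding resolves_def by blast
  obtain \<Phi>' \<Psi>' E' H where
    rel': "stable_equiv n (e (Suc i)) (kernel_of n (e (Suc i)) (e i) (M i)) (t (Suc i)) (kernel_of n (t (Suc i)) (t i) (T i)) \<Phi>' \<Psi>' E'"
    and H: "graded_map n (e i) (e (Suc i)) H" "\<Psi>' * \<Phi>' = 1\<^sub>m (length (e (Suc i))) + E' + H * M i"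
    by (rule stable_equiv_kernel[OF rel gM refl gT refl])
  have g': "graded_map n (e (Suc i)) (t (Suc i)) \<Phi>'" "graded_map n (t (Suc i)) (e (Suc i)) \<Psi>'"
    "graded_map n (e (Suc i)) (e (Suc i)) E'"
    and E'im: "\<And>v. v \<in> free_module n (length (e (Suc i))) \<Longrightarrow> E' *\<^sub>v v \<in> kernel_of n (e (Suc i)) (e i) (M i)"
    using rel' unfolding stable_equiv_def by auto
  let ?l = "length (e (Suc i))"
  note cM = graded_map_carrier[OF gM[of i]] and cE = graded_map_carrier[OF g'(3)] and cH = graded_map_carrier[OF H(1)]
  have E0: "lookup (E' $$ (r, s)) 0 = 0" if "r < ?l" "s < ?l" for r s
  proof -
    have "E' *\<^sub>v unit_vec ?l s \<in> image_of n (e (Suc (Suc i))) (M (Suc i))"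
      using E'im[OF free_module_unit] M(1) unfolding resolves_def by blast
    then obtain w where w: "w \<in> free_module n (length (e (Suc (Suc i))))" "E' *\<^sub>v unit_vec ?l s = M (Suc i) *\<^sub>v w"
      by blast
    have "E' $$ (r, s) = (M (Suc i) *\<^sub>v w) $ r"
      using mult_mat_unit_vec[OF cE that(2)] w(2) that cE by (metis carrier_matD index_col)
    then show ?thesis
      using const_free_mult_vec[OF M(2) graded_map_carrier[OF gM] free_module_carrier[OF w(1)] that(1)]
      by simp
  qed
  have HM0: "lookup ((H * M i) $$ (r, s)) 0 = 0" if "r < ?l" "s < ?l" for r s
    using M(2)[of i] cM that
    by (subst mult_mat_nth[OF cH cM that]) (auto simp: const_free_def lookup_sum lookup_mult_0)
  show ?thesis
  proof (rule count_list_le_of_left_inverse[OF g'(1,2)])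
    fix r s assume rs: "r < ?l" "s < ?l"
    have "(\<Psi>' * \<Phi>') $$ (r, s) = 1\<^sub>m ?l $$ (r, s) + E' $$ (r, s) + (H * M i) $$ (r, s)"
      unfolding H(2) using rs cE cH cM by auto
    then show "lookup ((\<Psi>' * \<Phi>') $$ (r, s)) 0 = (if r = s then 1 else 0)"
      using rs by (simp add: lookup_add E0 HM0)
  qed
qed

text \<open>The columns of \<open>M (Suc k)\<close> lie in the kernel of \<open>M k\<close>, whose
  vectors have no constant terms; those of \<open>M 0\<close> are elements of \<open>I\<close>,
  which is where the hypothesis on \<open>I\<close> enters.\<close>

lemma resolves_minimal_exists_const_free:
  assumes "resolves n I t T" "\<And>p. p \<in> I \<Longrightarrow> lookup p 0 = 0"
  obtains e M where "resolves n I e M" "\<And>i. const_free (M i)"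
proof -
  obtain e M where M: "resolves n I e M"
    "\<And>i v j. v \<in> kernel_of n (e (Suc i)) (e i) (M i) \<Longrightarrow> j < length (e (Suc i)) \<Longrightarrow> lookup (v $ j) 0 = 0"
    by (rule resolves_minimal_exists[OF assms(1)]) blast
  have c: "M i \<in> carrier_mat (length (e i)) (length (e (Suc i)))" for i
    by (rule resolves_carrier[OF M(1)])
  have col: "col (M i) j \<in> image_of n (e (Suc i)) (M i)" if "j < length (e (Suc i))" for i j
    unfolding mult_mat_unit_vec[OF c that, symmetric] by (intro imageI free_module_unit)
  have "const_free (M i)" for i
    unfolding const_free_def
  proof (intro allI impI)
    fix r j assume "r < dim_row (M i)" "j < dim_col (M i)"
    then have rj: "r < length (e i)" "j < length (e (Suc i))" using c[of i] by auto
    have eq: "M i $$ (r, j) = col (M i) j $ r" using rj c[of i] by auto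
    show "lookup (M i $$ (r, j)) 0 = 0"
    proof (cases i)
      case 0
      have "col (M i) j \<in> (\<lambda>p. vec 1 (\<lambda>_. p)) ` I" "length (e i) = 1"
        using col[OF rj(2)] resolves_image[OF M(1)] resolves_0[OF M(1)] unfolding 0 by auto
      then show ?thesis unfolding eq using rj(1) assms(2) by auto
    next
      case (Suc k)
      have "col (M i) j \<in> kernel_of n (e (Suc k)) (e k) (M k)"
        using col[OF rj(2)] resolves_exact[OF M(1), of k] unfolding Suc by simp
      then show ?thesis unfolding eq using M(2) rj(1) Suc by blast
    qed
  qed
  with M(1) that show ?thesis by blast
qed

text \<open>No column is zero: otherwise a unit vector would lie in the kernel, hence in the image
  of a \<open>const_free\<close> matrix. A non-zero entry without constant term has degree at least
  1, so each generator has larger degree than some generator one step earlier; the chain ends at an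
  element of \<open>I\<close>, of degree at least \<open>s\<close>.\<close>

lemma minimal_resolution_degree_ge:
  fixes I :: "'k::field poly_nat set"
  assumes M: "resolves n I e M" "\<And>i. const_free (M i)"
    and deg: "\<And>p m. p \<in> I \<Longrightarrow> m \<in> keys p \<Longrightarrow> s \<le> monom_degree m"
    and j: "j < length (e (Suc i))"
  shows "int (s + i) \<le> e (Suc i) ! j"
proof -
  have g: "graded_map n (e (Suc i)) (e i) (M i)" for i
    by (rule resolves_graded_map[OF M(1)])
  note c = graded_map_carrier[OF g]
  have nz: "\<exists>r<length (e i). M i $$ (r, j) \<noteq> 0" if j: "j < length (e (Suc i))" for i j
  proof (rule ccontr)
    let ?u = "unit_vec (length (e (Suc i))) j :: 'k poly_nat vec"
    assume "\<not> (\<exists>r<length (e i). M i $$ (r, j) \<noteq> 0)"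
    then have "M i *\<^sub>v ?u = 0\<^sub>v (length (e i))"
      using c[of i] j by (subst mult_mat_unit_vec[OF c j]) (auto intro!: eq_vecI)
    then have "?u \<in> image_of n (e (Suc (Suc i))) (M (Suc i))"
      unfolding resolves_exact[OF M(1), symmetric] kernel_of_def using free_module_unit by simp
    then obtain w where w: "w \<in> free_module n (length (e (Suc (Suc i))))" "?u = M (Suc i) *\<^sub>v w"
      by blast
    have "lookup (?u $ j) 0 = 0"
      unfolding w(2) by (rule const_free_mult_vec[OF M(2) c free_module_carrier[OF w(1)] j])
    then show False using j by simp
  qed
  show ?thesis using j
  proof (induction i arbitrary: j)
    case 0
    have e0: "e 0 = [0]" by (rule resolves_0[OF M(1)])
    then have "M 0 $$ (0, j) \<noteq> 0" using nz[OF 0] by simp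
    then obtain m where m: "m \<in> keys (M 0 $$ (0, j))" by (metis in_keys_iff lookup_zero poly_mapping_eqI)
    have "col (M 0) j \<in> image_of n (e 1) (M 0)"
      unfolding mult_mat_unit_vec[OF c 0, symmetric] One_nat_def by (intro imageI free_module_unit)
    then obtain p where p: "p \<in> I" "col (M 0) j = vec 1 (\<lambda>_. p)"
      unfolding resolves_image[OF M(1)] by auto
    have "M 0 $$ (0, j) = col (M 0) j $ 0"
      using c[of 0] 0 e0 by auto
    then have "M 0 $$ (0, j) \<in> I"
      using p by simp
    then have "s \<le> monom_degree m" using deg m by blast
    moreover have "int (monom_degree m) = e 1 ! j"
      using graded_map_homogeneous[OF g[of 0], of 0 j] 0 e0 m by (simp add: homogeneous_def)
    ultimately show ?case by simp
  next
    case (Suc i)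
    obtain r where r: "r < length (e (Suc i))" "M (Suc i) $$ (r, j) \<noteq> 0"
      using nz[OF Suc.prems] by blast
    have "lookup (M (Suc i) $$ (r, j)) 0 = 0"
      using M(2)[of "Suc i"] c[of "Suc i"] r(1) Suc.prems by (auto simp: const_free_def)
    then have "1 \<le> e (Suc (Suc i)) ! j - e (Suc i) ! r"
      using homogeneous_pos[OF graded_map_homogeneous[OF g r(1) Suc.prems] r(2)] by blast
    then show ?case using Suc.IH[OF r(1)] by simp
  qed
qed

section \<open>Passage between resolutions of the ideal and of its quotient ring\<close>

lemma graded_free_resolution_resolves:
  assumes "graded_free_resolution n I a g D"
  shows "resolves n I (case_nat [0] a) (case_nat (mat 1 (length (a 0)) (\<lambda>(_, j). g $ j)) D)"
proof -
  let ?G = "mat 1 (length (a 0)) (\<lambda>(_, j). g $ j)"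
  note r = assms[unfolded graded_free_resolution_def]
  have g: "g \<in> free_module n (length (a 0))" using r by blast
  have G: "?G *\<^sub>v v = vec 1 (\<lambda>_. g \<bullet> v)" if "v \<in> free_module n (length (a 0))" for v
    using g that by (intro eq_vecI) (auto simp: free_module_iff scalar_prod_def intro!: sum.cong)
  have v0: "vec 1 (\<lambda>_. p) = 0\<^sub>v 1 \<longleftrightarrow> p = 0" for p :: "'a poly_nat"
    by (metis eq_vecI index_vec index_zero_vec less_one dim_vec)
  have "graded_map n (a 0) [0] ?G"
    using r by (auto simp: graded_map_def free_module_iff)
  moreover have "image_of n (a 0) ?G = (\<lambda>p. vec 1 (\<lambda>_. p)) ` I"
  proof -
    have "image_of n (a 0) ?G = (\<lambda>v. vec 1 (\<lambda>_. g \<bullet> v)) ` free_module n (length (a 0))"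
      using G by (intro image_cong) auto
    also have "\<dots> = (\<lambda>p. vec 1 (\<lambda>_. p)) ` ((\<lambda>v. g \<bullet> v) ` free_module n (length (a 0)))"
      by (simp add: image_image)
    finally show ?thesis using r by simp
  qed
  moreover have "kernel_of n (a 0) [0] ?G = image_of n (a 1) (D 0)"
  proof -
    have "kernel_of n (a 0) [0] ?G = {v \<in> free_module n (length (a 0)). g \<bullet> v = 0}"
      unfolding kernel_of_def using G v0 by (auto simp del: index_zero_vec)
    then show ?thesis using r by simp
  qed
  ultimately show ?thesis
    using r unfolding resolves_def kernel_of_def by (auto split: nat.split)
qed

lemma resolves_graded_free_resolution:
  assumes "resolves n I e M"
  shows "graded_free_resolution n I (e \<circ> Suc) (row (M 0) 0) (M \<circ> Suc)"
proof -
  let ?g = "row (M 0) 0"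
  note r = assms[unfolded resolves_def]
  have gM: "graded_map n (e 1) [0] (M 0)" using r by (metis One_nat_def)
  note c = graded_map_carrier[OF gM]
  have G: "M 0 *\<^sub>v v = vec 1 (\<lambda>_. ?g \<bullet> v)" for v
    using c by (intro eq_vecI) auto
  have v0: "vec 1 (\<lambda>_. p) = 0\<^sub>v 1 \<longleftrightarrow> p = 0" for p :: "'a poly_nat"
    by (metis eq_vecI index_vec index_zero_vec less_one dim_vec)
  have inj: "inj (\<lambda>p::'a poly_nat. vec 1 (\<lambda>_. p))"
    by (rule injI) (metis index_vec less_one)
  have "(\<lambda>p. vec 1 (\<lambda>_. p)) ` ((\<lambda>v. ?g \<bullet> v) ` free_module n (length (e 1))) = (\<lambda>p. vec 1 (\<lambda>_. p)) ` I"
    using r G by (simp add: image_image)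
  then have "(\<lambda>v. ?g \<bullet> v) ` free_module n (length (e 1)) = I"
    using inj by (simp add: inj_image_eq_iff)
  moreover have "{v \<in> free_module n (length (e 1)). ?g \<bullet> v = 0} = image_of n (e 2) (M 1)"
  proof -
    have "{v \<in> free_module n (length (e 1)). ?g \<bullet> v = 0} = kernel_of n (e 1) [0] (M 0)"
      unfolding kernel_of_def G using v0 by auto
    then show ?thesis using r by (metis One_nat_def numeral_2_eq_2)
  qed
  moreover have "?g \<in> free_module n (length (e 1))" "\<forall>j<length (e 1). homogeneous (?g $ j) (e 1 ! j)"
    using gM c by (auto simp: graded_map_def free_module_iff)
  ultimately show ?thesis
    using r unfolding graded_free_resolution_def kernel_of_def
    by (simp add: numeral_2_eq_2)
qed

lemma minimal_graded_free_resolution_resolves: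
  assumes "minimal_graded_free_resolution n I a g D" "\<And>p. p \<in> I \<Longrightarrow> lookup p 0 = 0"
  obtains M where "resolves n I (case_nat [0] a) M" "\<And>i. const_free (M i)"
proof -
  define M where "M = case_nat (mat 1 (length (a 0)) (\<lambda>(_, j). g $ j)) D"
  have r: "graded_free_resolution n I a g D"
    and m: "\<And>i r c. r < length (a i) \<Longrightarrow> c < length (a (Suc i)) \<Longrightarrow> lookup (D i $$ (r, c)) 0 = 0"
    using assms(1) unfolding minimal_graded_free_resolution_def by blast+
  have "const_free (M i)" for i
  proof (cases i)
    case 0
    have "g $ j \<in> I" if j: "j < length (a 0)" for j
    proof -
      have "g \<in> carrier_vec (length (a 0))"
        using r unfolding graded_free_resolution_def by (auto dest: free_module_carrier)
      then have "g $ j = g \<bullet> unit_vec (length (a 0)) j" using j by simp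
      then show ?thesis
        using r free_module_unit unfolding graded_free_resolution_def by (metis image_eqI)
    qed
    then show ?thesis using assms(2) by (auto simp: const_free_def M_def 0)
  next
    case (Suc k)
    have "graded_map n (a (Suc k)) (a k) (D k)"
      using r by (simp add: graded_free_resolution_def)
    then have "D k \<in> carrier_mat (length (a k)) (length (a (Suc k)))"
      by (rule graded_map_carrier)
    then show ?thesis using m by (auto simp: const_free_def M_def Suc)
  qed
  then show ?thesis
    using that graded_free_resolution_resolves[OF r] unfolding M_def by blast
qed

lemma resolves_minimal_graded_free_resolution:
  assumes "resolves n I e M" "\<And>i. const_free (M i)"
  shows "minimal_graded_free_resolution n I (e \<circ> Suc) (row (M 0) 0) (M \<circ> Suc)"
  unfolding minimal_graded_free_resolution_def
proof (intro conjI allI impI)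
  show "graded_free_resolution n I (e \<circ> Suc) (row (M 0) 0) (M \<circ> Suc)"
    by (rule resolves_graded_free_resolution[OF assms(1)])
next
  fix i r c assume "r < length ((e \<circ> Suc) i)" "c < length ((e \<circ> Suc) (Suc i))"
  then show "lookup ((M \<circ> Suc) i $$ (r, c)) 0 = 0"
    using assms(2)[of "Suc i"] resolves_carrier[OF assms(1), of "Suc i"] by (simp add: const_free_def)
qed

text \<open>The definite description is well defined: the given resolution is a witness, and any
  other minimal one has the same ranks by comparison in both directions. The hypothesis on
  \<open>I\<close> makes the augmentation of that other resolution \<open>const_free\<close> as
  well.\<close>

theorem betti_eq_count_list:
  assumes "resolves n I e M" "\<And>i. const_free (M i)" "\<And>p. p \<in> I \<Longrightarrow> lookup p 0 = 0"
  shows "betti n I i d = count_list (e (Suc i)) d"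
  unfolding betti_def
proof (rule the_equality)
  show "\<exists>a g D. minimal_graded_free_resolution n I a g D \<and> count_list (e (Suc i)) d = count_list (a i) d"
    using resolves_minimal_graded_free_resolution[OF assms(1,2)] by (metis comp_apply)
next
  fix b assume "\<exists>a g D. minimal_graded_free_resolution n I a g D \<and> b = count_list (a i) d"
  then obtain a g D where D: "minimal_graded_free_resolution n I a g D" "b = count_list (a i) d" by blast
  obtain M' where M': "resolves n I (case_nat [0] a) M'" "\<And>i. const_free (M' i)"
    by (rule minimal_graded_free_resolution_resolves[OF D(1) assms(3)]) blast+
  show "b = count_list (e (Suc i)) d"
    using minimal_resolution_count_le[OF assms(1,2) M'(1), of i d]
      minimal_resolution_count_le[OF M' assms(1), of i d] D(2) by simp
qed

text \<open>The existence of a minimal resolution is essential even for this inequality, as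
  \<open>betti\<close> would be unspecified without one.\<close>

theorem betti_le_count_list:
  assumes "resolves n I t T" "\<And>p. p \<in> I \<Longrightarrow> lookup p 0 = 0"
  shows "betti n I i d \<le> count_list (t (Suc i)) d"
proof -
  obtain e M where M: "resolves n I e M" "\<And>i. const_free (M i)"
    by (rule resolves_minimal_exists_const_free[OF assms]) blast+
  show ?thesis
    using betti_eq_count_list[OF M assms(2)] minimal_resolution_count_le[OF M assms(1)] by metis
qed

theorem betti_eq_0_below:
  assumes "resolves n I t T" "\<And>p. p \<in> I \<Longrightarrow> lookup p 0 = 0"
    and "\<And>p m. p \<in> I \<Longrightarrow> m \<in> keys p \<Longrightarrow> s \<le> monom_degree m"
    and d: "d < int (s + i)"
  shows "betti n I i d = 0"
proof -
  obtain e M where M: "resolves n I e M" "\<And>i. const_free (M i)"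
    by (rule resolves_minimal_exists_const_free[OF assms(1,2)]) blast+
  have "d \<notin> set (e (Suc i))"
  proof
    assume "d \<in> set (e (Suc i))"
    then obtain j where j: "j < length (e (Suc i))" "d = e (Suc i) ! j"
      by (metis in_set_conv_nth)
    have "int (s + i) \<le> e (Suc i) ! j"
      by (rule minimal_resolution_degree_ge[OF M assms(3) j(1)])
    then show False using d j(2) by simp
  qed
  then show ?thesis
    using betti_eq_count_list[OF M assms(2)] by (simp add: count_list_0_iff)
qed

subsection \<open>The simplicial strands of the Taylor complex\<close>

text \<open>The incidence sign of the face S in the simplex \<open>insert s S\<close>, given by the
  number of vertices before s.\<close>

definition index_sign :: "nat \<Rightarrow> nat set \<Rightarrow> 'k::comm_ring_1" where
  "index_sign s S = (-1) ^ card {t \<in> S. t < s}"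

lemma index_sign_insert_less:
  assumes "finite S" "s \<notin> S" "s < t"
  shows "index_sign t (insert s S) = - index_sign t S"
proof -
  have "{u \<in> insert s S. u < t} = insert s {u \<in> S. u < t}" using assms(3) by auto
  then show ?thesis using assms by (simp add: index_sign_def)
qed

lemma index_sign_insert_greater:
  assumes "s < t"
  shows "index_sign s (insert t S) = index_sign s S"
proof -
  have "{u \<in> insert t S. u < s} = {u \<in> S. u < s}" using assms by auto
  then show ?thesis by (simp add: index_sign_def)
qed

text \<open>The coefficient at S of the simplicial boundary of the chain \<open>c\<close> on the
  vertices \<open>{..<q}\<close>. Chains are coefficient functions, so the sum runs over the
  simplices having S as a facet.\<close>

definition strand_boundary :: "nat \<Rightarrow> (nat set \<Rightarrow> 'k::comm_ring_1) \<Rightarrow> nat set \<Rightarrow> 'k" where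
  "strand_boundary q c S = (\<Sum>s\<in>{..<q} - S. index_sign s S * c (insert s S))"

text \<open>Adding s and then t carries the opposite sign of adding t and then s; the double sum is
  folded onto s < t, where such pairs cancel.\<close>

lemma strand_boundary_boundary:
  assumes "finite S"
  shows "strand_boundary q (strand_boundary q c) S = 0"
proof -
  let ?N = "{..<q} - S"
  define F where "F = (\<lambda>s t. index_sign s S * (index_sign t (insert s S) * c (insert t (insert s S))))"
  have anti: "F s t + F t s = 0" if "s < t" "s \<in> ?N" "t \<in> ?N" for s t
    using that assms
    by (simp add: F_def index_sign_insert_less[of S s t] index_sign_insert_greater[of s t] insert_commute[of s t])
  have "strand_boundary q (strand_boundary q c) S = (\<Sum>s\<in>?N. \<Sum>t\<in>?N - {s}. F s t)"
    unfolding strand_boundary_def F_def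
    by (intro sum.cong refl) (auto simp: sum_distrib_left Diff_insert2[symmetric] intro!: sum.cong)
  also have "\<dots> = (\<Sum>s\<in>?N. \<Sum>t\<in>?N. if t \<noteq> s then F s t else 0)"
    by (intro sum.cong refl sum.mono_neutral_cong_left) auto
  also have "\<dots> = (\<Sum>s\<in>?N. \<Sum>t\<in>?N. (if s < t then F s t else 0) + (if t < s then F s t else 0))"
    by (intro sum.cong refl) auto
  also have "\<dots> = (\<Sum>s\<in>?N. \<Sum>t\<in>?N. if s < t then F s t else 0) + (\<Sum>s\<in>?N. \<Sum>t\<in>?N. if t < s then F s t else 0)"
    by (simp add: sum.distrib)
  also have "(\<Sum>s\<in>?N. \<Sum>t\<in>?N. if t < s then F s t else 0) = (\<Sum>s\<in>?N. \<Sum>t\<in>?N. if s < t then F t s else 0)"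
    by (rule sum.swap)
  also have "(\<Sum>s\<in>?N. \<Sum>t\<in>?N. if s < t then F s t else 0) + \<dots>
      = (\<Sum>s\<in>?N. \<Sum>t\<in>?N. if s < t then F s t + F t s else 0)"
    unfolding sum.distrib[symmetric] by (intro sum.cong refl) auto
  also have "\<dots> = 0"
    using anti by (intro sum.neutral ballI) auto
  finally show ?thesis .
qed

text \<open>The cone with apex the least vertex of A, which enters every simplex with sign +1. For
  empty A the two conditions contradict each other, so the unspecified minimum never
  matters.\<close>

definition strand_cone :: "nat set \<Rightarrow> (nat set \<Rightarrow> 'k::comm_ring_1) \<Rightarrow> nat set \<Rightarrow> 'k" where
  "strand_cone A c T = (if T \<subseteq> A \<and> Min A \<in> T then c (T - {Min A}) else 0)"

text \<open>The cone formula for cycles. If the apex a is not in T, the only contribution comes from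
  adding a to T, and it is \<open>c T\<close>. If T is U with a added, each further vertex s
  contributes the negative of the term of s in the boundary of \<open>c\<close> at U; that boundary
  vanishes, and its remaining term, the one of a, is \<open>c T\<close>.\<close>

lemma strand_boundary_cone:
  assumes A: "A \<subseteq> {..<q}" and c: "\<And>T. T \<subseteq> {..<q} \<Longrightarrow> c T \<noteq> 0 \<Longrightarrow> T \<subseteq> A"
    and cycle: "\<And>S. S \<subseteq> {..<q} \<Longrightarrow> card S = i \<Longrightarrow> strand_boundary q c S = 0"
    and T: "T \<subseteq> {..<q}" "card T = Suc i"
  shows "strand_boundary q (strand_cone A c) T = c T"
proof (cases "T \<subseteq> A")
  case False
  then have "strand_boundary q (strand_cone A c) T = 0"
    unfolding strand_boundary_def strand_cone_def by (intro sum.neutral) auto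
  then show ?thesis using c[OF T(1)] False by auto
next
  case True
  define a where "a = Min A"
  have fin: "finite A" "finite T" using A T(1) finite_subset by blast+
  have "A \<noteq> {}" using True T(2) by auto
  then have a: "a \<in> A" "\<And>s. s \<in> A \<Longrightarrow> a \<le> s" using fin by (auto simp: a_def)
  show ?thesis
  proof (cases "a \<in> T")
    case False
    have "a \<le> t" if "t \<in> T" for t using a(2)[of t] \<open>T \<subseteq> A\<close> that by auto
    then have "{t \<in> T. t < a} = {}" by fastforce
    then have sgn: "index_sign a T = (1::'a)"
      by (simp only: index_sign_def card.empty power_0)
    have "strand_boundary q (strand_cone A c) T
        = (\<Sum>s\<in>{..<q} - T. if s = a then c T else 0)"
      unfolding strand_boundary_def
    proof (intro sum.cong refl)
      fix s
      have "insert a T - {a} = T" using False by auto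
      then show "index_sign s T * strand_cone A c (insert s T) = (if s = a then c T else 0)"
        using False True a(1) sgn by (auto simp: strand_cone_def a_def[symmetric])
    qed
    also have "\<dots> = c T" using a(1) A False by auto
    finally show ?thesis .
  next
    case aT: True
    define U where "U = T - {a}"
    have U: "T = insert a U" "a \<notin> U" "finite U" "U \<subseteq> {..<q}" "card U = i"
      using aT fin T by (auto simp: U_def)
    have "a \<le> t" if "t \<in> U" for t using a(2)[of t] \<open>T \<subseteq> A\<close> that by (auto simp: U_def)
    then have "{t \<in> U. t < a} = {}" by fastforce
    then have sgn: "index_sign a U = (1::'a)"
      by (simp only: index_sign_def card.empty power_0)
    have "strand_boundary q (strand_cone A c) T = (\<Sum>s\<in>{..<q} - T. - (index_sign s U * c (insert s U)))"
      unfolding strand_boundary_def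
    proof (intro sum.cong refl)
      fix s assume s: "s \<in> {..<q} - T"
      show "index_sign s T * strand_cone A c (insert s T) = - (index_sign s U * c (insert s U))"
      proof (cases "s \<in> A")
        case True
        have "s \<noteq> a" using s aT by auto
        with a(2)[OF True] have "a < s" by simp
        then have "index_sign s T = (- index_sign s U :: 'a)"
          unfolding U(1) by (rule index_sign_insert_less[OF U(3,2)])
        moreover have "insert s T - {a} = insert s U" using \<open>s \<noteq> a\<close> U by auto
        ultimately show ?thesis
          using True \<open>T \<subseteq> A\<close> aT by (simp add: strand_cone_def a_def[symmetric])
      next
        case False
        then have "c (insert s U) = 0" using c[of "insert s U"] U(4) s by auto
        then show ?thesis using False by (simp add: strand_cone_def)
      qed
    qed
    also have "\<dots> = - (\<Sum>s\<in>{..<q} - T. index_sign s U * c (insert s U))"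
      by (rule sum_negf)
    also have "(\<Sum>s\<in>{..<q} - T. index_sign s U * c (insert s U)) = - c T"
    proof -
      have "{..<q} - U = insert a ({..<q} - T)" using U(1,2) a(1) A by auto
      moreover have "a \<notin> {..<q} - T" using aT by simp
      ultimately have "strand_boundary q c U
          = index_sign a U * c (insert a U) + (\<Sum>s\<in>{..<q} - T. index_sign s U * c (insert s U))"
        unfolding strand_boundary_def by simp
      then show ?thesis using cycle[OF U(4,5)] sgn U(1) by (simp add: eq_neg_iff_add_eq_0 add.commute)
    qed
    finally show ?thesis by simp
  qed
qed

subsection \<open>The Taylor resolution\<close>

definition monom_dvd :: "(nat \<Rightarrow>\<^sub>0 nat) \<Rightarrow> (nat \<Rightarrow>\<^sub>0 nat) \<Rightarrow> bool" where
  "monom_dvd a b \<longleftrightarrow> (\<exists>u. b = a + u)"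

lemma monom_dvd_diff: "monom_dvd a b \<Longrightarrow> a + (b - a) = b"
  by (auto simp: monom_dvd_def)

lemma monom_dvd_add [simp]: "monom_dvd a (a + b)"
  by (auto simp: monom_dvd_def)

lemma monom_dvd_refl [simp]: "monom_dvd a a"
  unfolding monom_dvd_def by (rule exI[of _ 0]) simp

lemma monom_dvd_trans: "monom_dvd a b \<Longrightarrow> monom_dvd b c \<Longrightarrow> monom_dvd a c"
  unfolding monom_dvd_def by (metis add.assoc)

lemma monom_dvd_lookup: "monom_dvd a b \<Longrightarrow> lookup a i \<le> lookup b i"
  by (auto simp: monom_dvd_def lookup_add)

lemma monom_dvd_antisym: "monom_dvd a b \<Longrightarrow> monom_dvd b a \<Longrightarrow> a = b"
  by (intro poly_mapping_eqI antisym monom_dvd_lookup)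

lemma monom_dvd_keys: "monom_dvd a b \<Longrightarrow> keys a \<subseteq> keys b"
  by (rule subsetI) (metis in_keys_iff le_zero_eq monom_dvd_lookup)

lemma monom_dvd_add_cancel: "monom_dvd (a + b) (a + c) \<longleftrightarrow> monom_dvd b c"
  by (simp add: monom_dvd_def add.assoc)

text \<open>\<open>lc S\<close> is the least common multiple of the generators in S. It is fixed by
  its universal property, so that exactness can be proved without computing exponents.\<close>

locale taylor =
  fixes n q :: nat and \<mu> :: "nat \<Rightarrow> (nat \<Rightarrow>\<^sub>0 nat)" and lc :: "nat set \<Rightarrow> (nat \<Rightarrow>\<^sub>0 nat)"
  assumes lc_dvd: "\<And>S w. S \<subseteq> {..<q} \<Longrightarrow> monom_dvd (lc S) w \<longleftrightarrow> (\<forall>s\<in>S. monom_dvd (\<mu> s) w)"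
    and lc_vars: "\<And>S. S \<subseteq> {..<q} \<Longrightarrow> keys (lc S) \<subseteq> {1..n}"
begin

definition monomial_ideal :: "'k::field poly_nat set" where
  "monomial_ideal = {\<Sum>s<q. single (\<mu> s) 1 * f s | f. \<forall>s<q. f s \<in> polys n}"

text \<open>Indexing by cardinality puts the empty face, that is the ring itself, in place 0 and the
  generators in place 1, as \<open>resolves\<close> expects.\<close>

definition faces :: "nat \<Rightarrow> nat set list" where
  "faces i = filter (\<lambda>S. card S = i) (map set (subseqs [0..<q]))"

lemma distinct_faces: "distinct (faces i)"
  unfolding faces_def by (intro distinct_filter distinct_set_subseqs) simp

lemma set_faces: "set (faces i) = {S. S \<subseteq> {..<q} \<and> card S = i}"
  using subseqs_powset[of "[0..<q]"] by (auto simp: faces_def lessThan_atLeast0 image_iff set_eq_iff)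

lemma faces_0: "faces 0 = [{}]"
proof -
  have "set (faces 0) = {{}}"
    unfolding set_faces by (auto dest: finite_subset[OF _ finite_lessThan])
  moreover from this have "length (faces 0) = 1"
    using distinct_card[OF distinct_faces[of 0]] by simp
  ultimately show ?thesis by (cases "faces 0") auto
qed

lemma lc_mono: "S \<subseteq> T \<Longrightarrow> T \<subseteq> {..<q} \<Longrightarrow> monom_dvd (lc S) (lc T)"
  using lc_dvd[of S "lc T"] lc_dvd[of T "lc T"] by auto

lemma lc_empty: "lc {} = 0"
  using lc_dvd[of "{}" 0] by (metis empty_iff empty_subsetI monom_dvd_antisym monom_dvd_def add_0)

lemma lc_singleton: "s < q \<Longrightarrow> lc {s} = \<mu> s"
  using lc_dvd[of "{s}" "\<mu> s"] lc_dvd[of "{s}" "lc {s}"] by (auto intro: monom_dvd_antisym)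

text \<open>At most one summand is non-zero, because T and S determine the added vertex; the sum
  form yields 0 when S is not a facet of T.\<close>

definition entry :: "nat set \<Rightarrow> nat set \<Rightarrow> 'k::field poly_nat" where
  "entry S T = (\<Sum>s\<in>{..<q} - S. if T = insert s S then single (lc T - lc S) (index_sign s S) else 0)"

definition degrees :: "nat \<Rightarrow> int list" where
  "degrees i = map (\<lambda>S. int (monom_degree (lc S))) (faces i)"

definition diff_mat :: "nat \<Rightarrow> 'k::field poly_nat mat" where
  "diff_mat i = family_mat (length (faces i)) (faces (Suc i)) (\<lambda>r. entry (faces i ! r))"

definition boundary :: "(nat set \<Rightarrow> 'k::field poly_nat) \<Rightarrow> nat set \<Rightarrow> 'k poly_nat" where
  "boundary f S = (\<Sum>s\<in>{..<q} - S. single (lc (insert s S) - lc S) (index_sign s S) * f (insert s S))"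

lemma length_degrees [simp]: "length (degrees i) = length (faces i)"
  by (simp add: degrees_def)

lemma entry_boundary:
  assumes "S \<in> set (faces i)"
  shows "(\<Sum>T\<in>set (faces (Suc i)). entry S T * f T) = boundary f S"
proof -
  have S: "S \<subseteq> {..<q}" "card S = i" "finite S"
    using assms finite_subset by (auto simp: set_faces)
  have "(\<Sum>T\<in>set (faces (Suc i)). entry S T * f T)
      = (\<Sum>T\<in>set (faces (Suc i)). \<Sum>s\<in>{..<q} - S. if T = insert s S then single (lc T - lc S) (index_sign s S) * f T else 0)"
    unfolding entry_def sum_distrib_right by (intro sum.cong refl) simp
  also have "\<dots> = (\<Sum>s\<in>{..<q} - S. \<Sum>T\<in>set (faces (Suc i)). if T = insert s S then single (lc T - lc S) (index_sign s S) * f T else 0)"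
    by (rule sum.swap)
  also have "\<dots> = boundary f S"
    unfolding boundary_def
  proof (intro sum.cong refl)
    fix s assume "s \<in> {..<q} - S"
    then have "insert s S \<in> set (faces (Suc i))" using S by (auto simp: set_faces)
    then show "(\<Sum>T\<in>set (faces (Suc i)). if T = insert s S then single (lc T - lc S) (index_sign s S) * f T else 0)
        = single (lc (insert s S) - lc S) (index_sign s S) * f (insert s S)"
      by (simp add: sum.delta')
  qed
  finally show ?thesis .
qed

lemma diff_mat_mult:
  assumes "dim_vec v = length (faces (Suc i))" "\<And>j. j < length (faces (Suc i)) \<Longrightarrow> v $ j = f (faces (Suc i) ! j)"
  shows "diff_mat i *\<^sub>v v = vec (length (faces i)) (\<lambda>r. boundary f (faces i ! r))"
  unfolding diff_mat_def
  by (subst family_mat_mult[OF distinct_faces assms]) (auto intro!: eq_vecI simp: entry_boundary[OF nth_mem])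

lemma entry_graded:
  assumes "S \<subseteq> {..<q}" "T \<subseteq> {..<q}"
  shows "entry S T \<in> polys n"
    and "homogeneous (entry S T) (int (monom_degree (lc T)) - int (monom_degree (lc S)))"
proof -
  have *: "keys (lc T - lc S) \<subseteq> {1..n} \<and> monom_degree (lc T) = monom_degree (lc S) + monom_degree (lc T - lc S)"
    if "T = insert s S" for s
  proof -
    have eq: "lc S + (lc T - lc S) = lc T"
      using that assms by (intro monom_dvd_diff lc_mono) auto
    then have "monom_dvd (lc T - lc S) (lc T)"
      unfolding monom_dvd_def by (metis add.commute)
    then have "keys (lc T - lc S) \<subseteq> {1..n}"
      using lc_vars[OF assms(2)] monom_dvd_keys by blast
    then show ?thesis using eq monom_degree_add by metis
  qed
  show "entry S T \<in> polys n"
    unfolding entry_def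
  proof (intro polys_sum)
    fix s
    show "(if T = insert s S then single (lc T - lc S) (index_sign s S) else 0) \<in> polys n"
      using *[of s] by (cases "T = insert s S") (simp_all add: polys_single)
  qed
  show "homogeneous (entry S T) (int (monom_degree (lc T)) - int (monom_degree (lc S)))"
    unfolding entry_def
  proof (intro homogeneous_sum)
    fix s
    show "homogeneous (if T = insert s S then single (lc T - lc S) (index_sign s S) else 0)
        (int (monom_degree (lc T)) - int (monom_degree (lc S)))"
      using *[of s] by (cases "T = insert s S") (auto intro!: homogeneous_single)
  qed
qed

lemma diff_mat_graded: "graded_map n (degrees (Suc i)) (degrees i) (diff_mat i)"
proof -
  have *: "faces i ! r \<subseteq> {..<q}" if "r < length (faces i)" for i r
    using nth_mem[OF that] by (auto simp: set_faces)
  show ?thesis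
    by (simp add: graded_map_def diff_mat_def family_mat_def degrees_def * entry_graded)
qed

text \<open>
  In a fixed multidegree \<open>W\<close> the complex is the augmented chain complex of the full simplex on the
  generators dividing \<open>W\<close>, which coning with its least vertex contracts.
\<close>

definition strand :: "(nat set \<Rightarrow> 'k::field poly_nat) \<Rightarrow> (nat \<Rightarrow>\<^sub>0 nat) \<Rightarrow> nat set \<Rightarrow> 'k" where
  "strand f W S = (if monom_dvd (lc S) W then lookup (f S) (W - lc S) else 0)"

lemma strand_add [simp]: "strand f (lc S + w) S = lookup (f S) w"
  by (simp add: strand_def)

definition divisors :: "(nat \<Rightarrow>\<^sub>0 nat) \<Rightarrow> nat set" where
  "divisors W = {s \<in> {..<q}. monom_dvd (\<mu> s) W}"

lemma lc_dvd_iff_divisors: "S \<subseteq> {..<q} \<Longrightarrow> monom_dvd (lc S) W \<longleftrightarrow> S \<subseteq> divisors W"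
  by (auto simp: lc_dvd divisors_def)

text \<open>The monomial in each entry makes up the difference of the multidegrees of the two faces,
  so that only the signs remain in multidegree W. If \<open>lc S\<close> does not divide W, neither
  does the multiple of any larger face, and both sides are 0.\<close>

lemma strand_of_boundary:
  assumes S: "S \<subseteq> {..<q}"
  shows "strand (boundary f) W S = strand_boundary q (strand f W) S"
proof (cases "monom_dvd (lc S) W")
  case True
  then obtain w where W: "W = lc S + w" by (auto simp: monom_dvd_def)
  have "strand (boundary f) W S
      = (\<Sum>s\<in>{..<q} - S. lookup (single (lc (insert s S) - lc S) (index_sign s S) * f (insert s S)) w)"
    unfolding W by (simp add: boundary_def lookup_sum)
  also have "\<dots> = strand_boundary q (strand f W) S"
    unfolding strand_boundary_def
  proof (intro sum.cong refl)
    fix s assume s: "s \<in> {..<q} - S"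
    define t where "t = lc (insert s S) - lc S"
    have t: "lc (insert s S) = lc S + t"
      unfolding t_def using s S by (intro monom_dvd_diff[symmetric] lc_mono) auto
    \<comment> \<open>The guard in \<open>lookup_single_times\<close>, divisibility of
      \<open>w\<close> by \<open>t\<close>, is divisibility of \<open>W\<close> by
      \<open>lc (insert s S)\<close>, the guard of \<open>strand\<close>.\<close>
    show "lookup (single (lc (insert s S) - lc S) (index_sign s S) * f (insert s S)) w
        = index_sign s S * strand f W (insert s S)"
      unfolding t_def[symmetric] lookup_single_times strand_def t W monom_dvd_add_cancel monom_dvd_def[symmetric]
      by (auto simp: monom_dvd_def add.assoc)
  qed
  finally show ?thesis .
next
  case False
  have "strand f W (insert s S) = 0" if "s \<in> {..<q} - S" for s
    using False monom_dvd_trans[OF lc_mono[of S "insert s S"]] that S by (auto simp: strand_def)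
  then show ?thesis using False by (simp add: strand_def[of "boundary f"] strand_boundary_def)
qed

lemma boundary_boundary:
  assumes "S \<subseteq> {..<q}"
  shows "boundary (boundary f) S = 0"
proof (rule poly_mapping_eqI)
  fix w
  have "lookup (boundary (boundary f) S) w = strand_boundary q (strand (boundary f) (lc S + w)) S"
    using strand_of_boundary[OF assms, of "boundary f" "lc S + w"] by simp
  also have "\<dots> = strand_boundary q (strand_boundary q (strand f (lc S + w))) S"
    unfolding strand_boundary_def[of q "strand (boundary f) (lc S + w)"]
      strand_boundary_def[of q "strand_boundary q (strand f (lc S + w))"]
    using assms by (intro sum.cong refl) (simp add: strand_of_boundary)
  also have "\<dots> = 0"
    by (rule strand_boundary_boundary) (rule finite_subset[OF assms finite_lessThan])
  finally show "lookup (boundary (boundary f) S) w = lookup 0 w" by simp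
qed

text \<open>The contractions of all multidegrees put together. The apex is the least generator
  dividing \<open>lc T + w\<close> and so varies with the monomial \<open>w\<close>; hence the
  coefficientwise definition, which need not be linear over the polynomial ring.\<close>

definition cone :: "(nat set \<Rightarrow> 'k::field poly_nat) \<Rightarrow> nat set \<Rightarrow> 'k poly_nat" where
  "cone f T = Abs_poly_mapping (\<lambda>w. strand_cone (divisors (lc T + w)) (strand f (lc T + w)) T)"

lemma strand_cone_nonzero:
  assumes "strand_cone (divisors (lc T + w)) (strand f (lc T + w)) T \<noteq> 0"
  obtains a k where "a \<in> T" "k \<in> keys (f (T - {a}))" "lc T + w = lc (T - {a}) + k"
proof -
  define W where "W = lc T + w"
  define a where "a = Min (divisors W)"
  have a: "a \<in> T" "strand f W (T - {a}) \<noteq> 0"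
    using assms by (auto simp: strand_cone_def W_def a_def split: if_splits)
  then have "W - lc (T - {a}) \<in> keys (f (T - {a}))" "W = lc (T - {a}) + (W - lc (T - {a}))"
    by (auto simp: strand_def in_keys_iff monom_dvd_diff split: if_splits)
  then show ?thesis using that a(1) unfolding W_def by blast
qed

text \<open>The coefficient function has finite support, as every non-zero coefficient comes from a
  term of \<open>f\<close> on one of the finitely many facets \<open>T - {a}\<close>.\<close>

lemma lookup_cone:
  assumes "finite T"
  shows "lookup (cone f T) w = strand_cone (divisors (lc T + w)) (strand f (lc T + w)) T"
proof -
  let ?h = "\<lambda>w. strand_cone (divisors (lc T + w)) (strand f (lc T + w)) T"
  have "{w. ?h w \<noteq> 0} \<subseteq> (\<Union>a\<in>T. (\<lambda>k. (lc (T - {a}) + k) - lc T) ` keys (f (T - {a})))"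
  proof
    fix w assume "w \<in> {w. ?h w \<noteq> 0}"
    then obtain a k where a: "a \<in> T" "k \<in> keys (f (T - {a}))" "lc T + w = lc (T - {a}) + k"
      using strand_cone_nonzero by blast
    then have "w = (lc (T - {a}) + k) - lc T" by (metis add_diff_cancel_left')
    then show "w \<in> (\<Union>a\<in>T. (\<lambda>k. (lc (T - {a}) + k) - lc T) ` keys (f (T - {a})))" using a by blast
  qed
  then have "finite {w. ?h w \<noteq> 0}" by (rule finite_subset) (use assms in auto)
  then show ?thesis unfolding cone_def by simp
qed

lemma cone_polys:
  assumes T: "T \<subseteq> {..<q}" and f: "\<And>a. a \<in> T \<Longrightarrow> f (T - {a}) \<in> polys n"
  shows "cone f T \<in> polys n"
  unfolding polys_iff
proof
  fix w assume "w \<in> keys (cone f T)"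
  then have "strand_cone (divisors (lc T + w)) (strand f (lc T + w)) T \<noteq> 0"
    by (simp add: in_keys_iff lookup_cone[OF finite_subset[OF T finite_lessThan]])
  then obtain a k where a: "a \<in> T" "k \<in> keys (f (T - {a}))" "lc T + w = lc (T - {a}) + k"
    by (rule strand_cone_nonzero)
  have "keys w \<subseteq> keys (lc T + w)"
    by (intro monom_dvd_keys) (metis add.commute monom_dvd_add)
  also have "\<dots> \<subseteq> keys (lc (T - {a})) \<union> keys k"
    unfolding a(3) by (rule Poly_Mapping.keys_add)
  also have "\<dots> \<subseteq> {1..n}"
    using lc_vars[of "T - {a}"] T f[OF a(1)] a(2) unfolding polys_iff by blast
  finally show "keys w \<subseteq> {1..n}" .
qed

lemma strand_of_cone:
  assumes "T \<subseteq> {..<q}"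
  shows "strand (cone f) W T = strand_cone (divisors W) (strand f W) T"
proof (cases "monom_dvd (lc T) W")
  case True
  then show ?thesis
    by (simp add: lookup_cone[OF finite_subset[OF assms finite_lessThan]] strand_def monom_dvd_diff)
next
  case False
  then show ?thesis
    using lc_dvd_iff_divisors[OF assms, of W] by (simp add: strand_def strand_cone_def)
qed

lemma boundary_cone:
  assumes cycle: "\<And>S. S \<subseteq> {..<q} \<Longrightarrow> card S = i \<Longrightarrow> boundary f S = 0"
    and T: "T \<subseteq> {..<q}" "card T = Suc i"
  shows "boundary (cone f) T = f T"
proof (rule poly_mapping_eqI)
  fix w
  define W where "W = lc T + w"
  have "lookup (boundary (cone f) T) w = strand_boundary q (strand (cone f) W) T"
    using strand_of_boundary[OF T(1), of "cone f" W] by (simp add: W_def)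
  also have "\<dots> = strand_boundary q (strand_cone (divisors W) (strand f W)) T"
    unfolding strand_boundary_def using T by (intro sum.cong refl) (simp add: strand_of_cone)
  also have "\<dots> = strand f W T"
  proof (rule strand_boundary_cone[OF _ _ _ T])
    fix S assume S: "S \<subseteq> {..<q}"
    show "S \<subseteq> divisors W" if "strand f W S \<noteq> 0"
      using that lc_dvd_iff_divisors[OF S] by (auto simp: strand_def split: if_splits)
    show "strand_boundary q (strand f W) S = 0" if "card S = i"
      unfolding strand_of_boundary[OF S, symmetric] using cycle[OF S that] by (simp add: strand_def)
  qed (auto simp: divisors_def)
  also have "\<dots> = lookup (f T) w" by (simp add: W_def)
  finally show "lookup (boundary (cone f) T) w = lookup (f T) w" .
qed

text \<open>A cycle \<open>f\<close> is the boundary of \<open>cone f\<close>; the other inclusion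
  is \<open>boundary_boundary\<close>.\<close>

lemma diff_mat_exact:
  "kernel_of n (degrees (Suc i)) (degrees i) (diff_mat i)
    = image_of n (degrees (Suc (Suc i))) (diff_mat (Suc i) :: 'k::field poly_nat mat)"
proof (intro equalityI subsetI)
  fix v :: "'k poly_nat vec"
  assume "v \<in> kernel_of n (degrees (Suc i)) (degrees i) (diff_mat i)"
  then have v: "v \<in> free_module n (length (faces (Suc i)))" "diff_mat i *\<^sub>v v = 0\<^sub>v (length (faces i))"
    by (auto simp: kernel_of_def)
  obtain f where f: "\<And>T. T \<in> set (faces (Suc i)) \<Longrightarrow> f T \<in> polys n"
    "\<And>j. j < length (faces (Suc i)) \<Longrightarrow> v $ j = f (faces (Suc i) ! j)"
    by (rule free_module_as_family[OF distinct_faces v(1)]) blast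
  have dv: "dim_vec v = length (faces (Suc i))" using v(1) by (simp add: free_module_iff)
  have cycle: "boundary f S = 0" if S: "S \<subseteq> {..<q}" "card S = i" for S
  proof -
    have "S \<in> set (faces i)" using S by (simp add: set_faces)
    then obtain r where r: "r < length (faces i)" "S = faces i ! r" by (metis in_set_conv_nth)
    have "boundary f S = (diff_mat i *\<^sub>v v) $ r"
      using r by (subst diff_mat_mult[OF dv f(2)]) auto
    then show ?thesis using r(1) v(2) by simp
  qed
  define w where "w = vec (length (faces (Suc (Suc i)))) (\<lambda>j. cone f (faces (Suc (Suc i)) ! j))"
  have "cone f T \<in> polys n" if "T \<in> set (faces (Suc (Suc i)))" for T
  proof -
    have T: "T \<subseteq> {..<q}" "card T = Suc (Suc i)" using that by (auto simp: set_faces)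
    then show ?thesis
      using finite_subset[OF T(1)] by (intro cone_polys f(1)) (auto simp: set_faces)
  qed
  then have w: "w \<in> free_module n (length (degrees (Suc (Suc i))))"
    by (auto simp: w_def free_module_iff)
  have "diff_mat (Suc i) *\<^sub>v w = vec (length (faces (Suc i))) (\<lambda>r. boundary (cone f) (faces (Suc i) ! r))"
    by (rule diff_mat_mult) (auto simp: w_def)
  also have "\<dots> = v"
  proof (rule eq_vecI)
    fix r assume "r < dim_vec v"
    then have r: "r < length (faces (Suc i))" using dv by simp
    then have "boundary (cone f) (faces (Suc i) ! r) = f (faces (Suc i) ! r)"
      using nth_mem[OF r] by (intro boundary_cone[OF cycle]) (auto simp: set_faces)
    then show "vec (length (faces (Suc i))) (\<lambda>r. boundary (cone f) (faces (Suc i) ! r)) $ r = v $ r"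
      using r f(2) by simp
  qed (simp add: dv)
  finally show "v \<in> image_of n (degrees (Suc (Suc i))) (diff_mat (Suc i))"
    using w by blast
next
  fix v :: "'k poly_nat vec"
  assume "v \<in> image_of n (degrees (Suc (Suc i))) (diff_mat (Suc i))"
  then obtain w where w: "w \<in> free_module n (length (faces (Suc (Suc i))))" "v = diff_mat (Suc i) *\<^sub>v w"
    by auto
  obtain f where f: "\<And>j. j < length (faces (Suc (Suc i))) \<Longrightarrow> w $ j = f (faces (Suc (Suc i)) ! j)"
    by (rule free_module_as_family[OF distinct_faces w(1)]) blast
  have dw: "dim_vec w = length (faces (Suc (Suc i)))" using w(1) by (simp add: free_module_iff)
  have v: "v = vec (length (faces (Suc i))) (\<lambda>r. boundary f (faces (Suc i) ! r))"
    unfolding w(2) by (rule diff_mat_mult[OF dw f])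
  have "diff_mat i *\<^sub>v v = vec (length (faces i)) (\<lambda>r. boundary (boundary f) (faces i ! r))"
    by (rule diff_mat_mult) (auto simp: v)
  also have "\<dots> = 0\<^sub>v (length (faces i))"
  proof (rule eq_vecI)
    fix r assume "r < dim_vec (0\<^sub>v (length (faces i)))"
    then have r: "r < length (faces i)" by simp
    then have "faces i ! r \<subseteq> {..<q}" using nth_mem[OF r] by (simp add: set_faces)
    then show "vec (length (faces i)) (\<lambda>r. boundary (boundary f) (faces i ! r)) $ r = 0\<^sub>v (length (faces i)) $ r"
      using r by (simp add: boundary_boundary)
  qed simp
  moreover have "v \<in> free_module n (length (degrees (Suc i)))"
    unfolding w(2) by (rule graded_map_mult_vec[OF diff_mat_graded]) (simp add: w(1))
  ultimately show "v \<in> kernel_of n (degrees (Suc i)) (degrees i) (diff_mat i)"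
    by (simp add: kernel_of_def)
qed

lemma diff_mat_image_0:
  "image_of n (degrees 1) (diff_mat 0) = (\<lambda>p. vec 1 (\<lambda>_. p)) ` (monomial_ideal :: 'k::field poly_nat set)"
proof -
  have b: "boundary f {} = (\<Sum>s<q. single (\<mu> s) 1 * f {s})" for f :: "nat set \<Rightarrow> 'k poly_nat"
    unfolding boundary_def by (intro sum.cong) (auto simp: lc_empty lc_singleton index_sign_def)
  have faces_1: "set (faces 1) = {{s} | s. s < q}"
    unfolding set_faces by (auto simp: card_1_singleton_iff)
  have mult: "diff_mat 0 *\<^sub>v v = vec 1 (\<lambda>_. \<Sum>s<q. single (\<mu> s) 1 * f {s})"
    if "dim_vec v = length (faces 1)" "\<And>j. j < length (faces 1) \<Longrightarrow> v $ j = f (faces 1 ! j)"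
    for v :: "'k poly_nat vec" and f
    using diff_mat_mult[of v 0 f] that b[of f] by (auto simp: faces_0 intro!: eq_vecI)
  show ?thesis
  proof (intro equalityI subsetI)
    fix x :: "'k poly_nat vec"
    assume "x \<in> image_of n (degrees 1) (diff_mat 0)"
    then obtain v where v: "v \<in> free_module n (length (faces 1))" "x = diff_mat 0 *\<^sub>v v" by auto
    obtain f where f: "\<And>T. T \<in> set (faces 1) \<Longrightarrow> f T \<in> polys n"
      "\<And>j. j < length (faces 1) \<Longrightarrow> v $ j = f (faces 1 ! j)"
      by (rule free_module_as_family[OF distinct_faces v(1)]) blast
    have x: "x = vec 1 (\<lambda>_. \<Sum>s<q. single (\<mu> s) 1 * f {s})"
      unfolding v(2) using v(1) by (intro mult f(2)) (auto simp: free_module_iff)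
    have "\<forall>s<q. f {s} \<in> polys n" using f(1) faces_1 by blast
    then have "(\<Sum>s<q. single (\<mu> s) 1 * f {s}) \<in> monomial_ideal"
      unfolding monomial_ideal_def by (intro CollectI exI[of _ "\<lambda>s. f {s}"]) simp
    then show "x \<in> (\<lambda>p. vec 1 (\<lambda>_. p)) ` monomial_ideal"
      unfolding x by blast
  next
    fix x :: "'k poly_nat vec"
    assume "x \<in> (\<lambda>p. vec 1 (\<lambda>_. p)) ` monomial_ideal"
    then obtain f where f: "\<forall>s<q. f s \<in> polys n" "x = vec 1 (\<lambda>_. \<Sum>s<q. single (\<mu> s) 1 * f s)"
      unfolding monomial_ideal_def by blast
    define v where "v = vec (length (faces 1)) (\<lambda>j. f (the_elem (faces 1 ! j)))"
    have "x = diff_mat 0 *\<^sub>v v"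
      unfolding f(2) by (subst mult[of v "\<lambda>T. f (the_elem T)"]) (auto simp: v_def)
    moreover have "f (the_elem T) \<in> polys n" if "T \<in> set (faces 1)" for T
      using that f(1) faces_1 by auto
    then have "v \<in> free_module n (length (degrees 1))"
      using nth_mem by (auto simp: v_def free_module_iff)
    ultimately show "x \<in> image_of n (degrees 1) (diff_mat 0)" by blast
  qed
qed

theorem taylor_resolves: "resolves n (monomial_ideal :: 'k::field poly_nat set) degrees diff_mat"
  unfolding resolves_def
proof (intro conjI allI)
  show "degrees 0 = [0]"
    by (simp add: degrees_def faces_0 lc_empty)
qed (rule diff_mat_graded diff_mat_image_0 diff_mat_exact)+

text \<open>A non-zero entry is a signed monomial with exponent \<open>lc T - lc S\<close>, which is
  constant only if the added generator leaves the least common multiple unchanged.\<close>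

lemma diff_mat_const_free:
  assumes "\<And>S s. S \<subseteq> {..<q} \<Longrightarrow> s < q \<Longrightarrow> s \<notin> S \<Longrightarrow> lc (insert s S) \<noteq> lc S"
  shows "const_free (diff_mat i :: 'k::field poly_nat mat)"
proof -
  have "lookup (entry S T :: 'k poly_nat) 0 = 0" if S: "S \<subseteq> {..<q}" for S T
    unfolding entry_def lookup_sum
  proof (intro sum.neutral ballI)
    fix s assume s: "s \<in> {..<q} - S"
    have "lc T - lc S \<noteq> 0" if "T = insert s S"
    proof
      assume "lc T - lc S = 0"
      moreover have "lc S + (lc T - lc S) = lc T"
        by (intro monom_dvd_diff lc_mono) (use that S s in auto)
      ultimately have "lc T = lc S" by simp
      then show False using assms[of S s] that S s by auto
    qed
    then show "lookup (if T = insert s S then single (lc T - lc S) (index_sign s S) else 0) 0 = (0::'k)"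
      by (auto simp: lookup_single when_def)
  qed
  moreover have "faces i ! r \<subseteq> {..<q}" if "r < length (faces i)" for r
    using nth_mem[OF that] by (simp add: set_faces)
  ultimately show ?thesis
    by (simp add: const_free_def diff_mat_def family_mat_def)
qed

lemma count_degrees: "count_list (degrees i) d = card {S. S \<subseteq> {..<q} \<and> card S = i \<and> int (monom_degree (lc S)) = d}"
proof -
  have "count_list (degrees i) d = length (filter (\<lambda>S. int (monom_degree (lc S)) = d) (faces i))"
    by (simp add: degrees_def count_list_eq_length_filter filter_map comp_def eq_commute[of d])
  also have "\<dots> = card (set (filter (\<lambda>S. int (monom_degree (lc S)) = d) (faces i)))"
    by (rule distinct_card[symmetric]) (simp add: distinct_faces)
  also have "set (filter (\<lambda>S. int (monom_degree (lc S)) = d) (faces i))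
      = {S. S \<subseteq> {..<q} \<and> card S = i \<and> int (monom_degree (lc S)) = d}"
    by (auto simp: set_faces)
  finally show ?thesis .
qed

lemma monomial_ideal_keys:
  assumes "p \<in> monomial_ideal" "m \<in> keys p"
  obtains s where "s < q" "monom_dvd (\<mu> s) m"
proof -
  obtain f where p: "p = (\<Sum>s<q. single (\<mu> s) 1 * f s)" using assms(1) unfolding monomial_ideal_def by blast
  then have "(\<Sum>s<q. lookup (single (\<mu> s) 1 * f s) m) \<noteq> 0"
    using assms(2) by (simp add: in_keys_iff lookup_sum)
  then obtain s where "s < q" "lookup (single (\<mu> s) 1 * f s) m \<noteq> 0"
    by (metis (no_types, lifting) lessThan_iff sum.neutral)
  then show ?thesis using that by (auto simp: lookup_single_times monom_dvd_def split: if_splits)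
qed

end

subsection \<open>Edge ideals\<close>

definition vertex_monom :: "nat set \<Rightarrow> (nat \<Rightarrow>\<^sub>0 nat)" where
  "vertex_monom V = (\<Sum>v\<in>V. single v 1)"

lemma lookup_vertex_monom: "finite V \<Longrightarrow> lookup (vertex_monom V) v = (if v \<in> V then 1 else 0)"
  by (simp add: vertex_monom_def lookup_sum lookup_single when_def)

lemma keys_vertex_monom: "finite V \<Longrightarrow> keys (vertex_monom V) = V"
  by (auto simp: in_keys_iff lookup_vertex_monom split: if_splits)

lemma monom_degree_vertex_monom: "finite V \<Longrightarrow> monom_degree (vertex_monom V) = card V"
  by (simp add: monom_degree_def keys_vertex_monom lookup_vertex_monom)

lemma vertex_monom_dvd_iff:
  assumes "finite V"
  shows "monom_dvd (vertex_monom V) w \<longleftrightarrow> (\<forall>v\<in>V. lookup w v \<noteq> 0)"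
proof
  assume "monom_dvd (vertex_monom V) w"
  then show "\<forall>v\<in>V. lookup w v \<noteq> 0"
    using assms by (auto simp: monom_dvd_def lookup_add lookup_vertex_monom)
next
  assume *: "\<forall>v\<in>V. lookup w v \<noteq> 0"
  have "w = vertex_monom V + (w - vertex_monom V)"
    using * assms by (intro poly_mapping_eqI) (auto simp: lookup_add lookup_minus lookup_vertex_monom)
  then show "monom_dvd (vertex_monom V) w" unfolding monom_dvd_def by blast
qed

lemma var_mult_var: "i \<noteq> j \<Longrightarrow> var i * var j = single (vertex_monom {i, j}) 1"
  by (simp add: var_def mult_single vertex_monom_def)

lemma poly_ring_simps:
  "zero (poly_ring n) = 0" "one (poly_ring n) = 1"
  "x \<oplus>\<^bsub>poly_ring n\<^esub> y = x + y" "x \<otimes>\<^bsub>poly_ring n\<^esub> y = x * y"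
  by (simp_all add: poly_ring_def)

lemma poly_ring_ring: "ring (poly_ring n :: 'k::field poly_nat ring)"
proof (rule ringI)
  show "abelian_group (poly_ring n :: 'k poly_nat ring)"
  proof (rule abelian_groupI)
    fix x :: "'k poly_nat" assume "x \<in> polys n"
    then show "\<exists>y\<in>polys n. y \<oplus>\<^bsub>poly_ring n\<^esub> x = zero (poly_ring n)"
      by (intro bexI[of _ "- x"]) (auto simp: poly_ring_simps polys_uminus)
  qed (auto simp: poly_ring_simps polys_add add.assoc add.commute)
  show "monoid (poly_ring n :: 'k poly_nat ring)"
    by (rule monoidI) (auto simp: poly_ring_simps polys_mult mult.assoc)
qed (auto simp: poly_ring_simps algebra_simps)

locale graph_edges =
  fixes n q :: nat and edge :: "nat \<Rightarrow> nat set"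
  assumes graph: "graph_on n (edge ` {..<q})"
begin

lemma edge_vertices: "s < q \<Longrightarrow> edge s \<subseteq> {1..n}"
  and card_edge: "s < q \<Longrightarrow> card (edge s) = 2"
  using graph by (auto simp: graph_on_def)

lemma finite_edge: "s < q \<Longrightarrow> finite (edge s)"
  using edge_vertices finite_subset by blast

lemma finite_cover: "S \<subseteq> {..<q} \<Longrightarrow> finite (\<Union>(edge ` S))"
  using finite_edge finite_subset[OF _ finite_lessThan] by blast

text \<open>Edge monomials are squarefree, so the least common multiple of a set of edges is the
  product of the vertices they cover, and its degree is the number of these vertices.\<close>

sublocale taylor n q "\<lambda>s. vertex_monom (edge s)" "\<lambda>S. vertex_monom (\<Union>(edge ` S))"
proof
  fix S :: "nat set" and w assume S: "S \<subseteq> {..<q}"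
  show "monom_dvd (vertex_monom (\<Union>(edge ` S))) w \<longleftrightarrow> (\<forall>s\<in>S. monom_dvd (vertex_monom (edge s)) w)"
  proof -
    have "monom_dvd (vertex_monom (edge s)) w \<longleftrightarrow> (\<forall>v\<in>edge s. lookup w v \<noteq> 0)" if "s \<in> S" for s
      using S that finite_edge by (intro vertex_monom_dvd_iff) auto
    then show ?thesis by (simp add: vertex_monom_dvd_iff[OF finite_cover[OF S]])
  qed
  show "keys (vertex_monom (\<Union>(edge ` S))) \<subseteq> {1..n}"
    using S finite_cover[OF S] edge_vertices by (auto simp: keys_vertex_monom)
qed

lemma generators:
  "{var i * var j | i j. {i, j} \<in> edge ` {..<q}} = (\<lambda>s. single (vertex_monom (edge s)) 1) ` {..<q}"
proof (intro equalityI subsetI)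
  fix x :: "'a poly_nat" assume "x \<in> {var i * var j | i j. {i, j} \<in> edge ` {..<q}}"
  then obtain i j s where s: "x = var i * var j" "{i, j} = edge s" "s < q" by auto
  have "i \<noteq> j" using card_edge[OF s(3)] unfolding s(2)[symmetric] by auto
  then show "x \<in> (\<lambda>s. single (vertex_monom (edge s)) 1) ` {..<q}"
    using s by (auto simp: var_mult_var)
next
  fix x :: "'a poly_nat" assume "x \<in> (\<lambda>s. single (vertex_monom (edge s)) 1) ` {..<q}"
  then obtain s where s: "x = single (vertex_monom (edge s)) 1" "s < q" by auto
  obtain i j where ij: "edge s = {i, j}" "i \<noteq> j" using card_edge[OF s(2)] by (auto simp: card_2_iff)
  have "x = var i * var j" using s(1) ij by (simp add: var_mult_var)
  moreover have "{i, j} \<in> edge ` {..<q}" unfolding ij(1)[symmetric] using s(2) by simp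
  ultimately show "x \<in> {var i * var j | i j. {i, j} \<in> edge ` {..<q}}" by blast
qed

lemma generator_polys: "s < q \<Longrightarrow> single (vertex_monom (edge s)) c \<in> polys n"
  using edge_vertices finite_edge by (intro polys_single) (simp add: keys_vertex_monom)

lemma monomial_ideal_ideal: "ideal (monomial_ideal :: 'k::field poly_nat set) (poly_ring n)"
proof (rule idealI[OF poly_ring_ring])
  let ?g = "\<lambda>s. single (vertex_monom (edge s)) 1 :: 'k poly_nat"
  have carrier: "monomial_ideal \<subseteq> (polys n :: 'k poly_nat set)"
    unfolding monomial_ideal_def by (auto intro!: polys_sum polys_mult generator_polys)
  have mult: "a * x \<in> monomial_ideal" if a: "a \<in> monomial_ideal" and x: "x \<in> polys n" for a x :: "'k poly_nat"
  proof -
    obtain f where f: "\<forall>s<q. f s \<in> polys n" "a = (\<Sum>s<q. ?g s * f s)"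
      using a unfolding monomial_ideal_def by blast
    have "a * x = (\<Sum>s<q. ?g s * (f s * x))"
      by (simp add: f(2) sum_distrib_right mult.assoc)
    moreover have "\<forall>s<q. f s * x \<in> polys n" using f(1) x by (simp add: polys_mult)
    ultimately show ?thesis
      unfolding monomial_ideal_def by (intro CollectI exI[of _ "\<lambda>s. f s * x"]) simp
  qed
  show "subgroup monomial_ideal (add_monoid (poly_ring n :: 'k poly_nat ring))"
  proof
    show "monomial_ideal \<subseteq> carrier (add_monoid (poly_ring n :: 'k poly_nat ring))"
      using carrier by simp
    show "\<one>\<^bsub>add_monoid (poly_ring n :: 'k poly_nat ring)\<^esub> \<in> monomial_ideal"
      unfolding monomial_ideal_def by (auto simp: poly_ring_simps intro!: exI[of _ "\<lambda>_. 0"])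
  next
    fix x y :: "'k poly_nat" assume "x \<in> monomial_ideal" "y \<in> monomial_ideal"
    then obtain f h where f: "\<forall>s<q. f s \<in> polys n" "x = (\<Sum>s<q. ?g s * f s)"
      and h: "\<forall>s<q. h s \<in> polys n" "y = (\<Sum>s<q. ?g s * h s)"
      unfolding monomial_ideal_def by blast
    have "x + y = (\<Sum>s<q. ?g s * (f s + h s))"
      by (simp add: f(2) h(2) distrib_left sum.distrib)
    moreover have "\<forall>s<q. f s + h s \<in> polys n" using f(1) h(1) by (simp add: polys_add)
    ultimately show "x \<otimes>\<^bsub>add_monoid (poly_ring n)\<^esub> y \<in> monomial_ideal"
      unfolding monomial_ideal_def
      by (intro CollectI exI[of _ "\<lambda>s. f s + h s"]) (simp add: poly_ring_simps)
  next
    fix x :: "'k poly_nat" assume x: "x \<in> monomial_ideal"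
    interpret R: ring "poly_ring n :: 'k poly_nat ring" by (rule poly_ring_ring)
    have xp: "x \<in> polys n" using x carrier by blast
    have "\<ominus>\<^bsub>poly_ring n\<^esub> x = - x"
      using xp by (intro R.minus_equality) (auto simp: poly_ring_simps polys_uminus)
    moreover have "- x \<in> monomial_ideal"
      using mult[OF x, of "- 1"] by (simp add: polys_uminus)
    ultimately show "inv\<^bsub>add_monoid (poly_ring n)\<^esub> x \<in> monomial_ideal"
      by (simp add: a_inv_def)
  qed
  fix a x :: "'k poly_nat" assume "a \<in> monomial_ideal" "x \<in> polys n"
  then show "x \<otimes>\<^bsub>poly_ring n\<^esub> a \<in> monomial_ideal" "a \<otimes>\<^bsub>poly_ring n\<^esub> x \<in> monomial_ideal"
    using mult by (simp_all add: poly_ring_simps mult.commute)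
qed

lemma edge_ideal_eq: "edge_ideal n (edge ` {..<q}) = (monomial_ideal :: 'k::field poly_nat set)"
proof (intro equalityI subsetI)
  let ?g = "\<lambda>s. single (vertex_monom (edge s)) 1 :: 'k poly_nat"
  have "?g s \<in> monomial_ideal" if s: "s < q" for s
  proof -
    have "(\<Sum>t<q. ?g t * (if t = s then 1 else 0)) = (\<Sum>t<q. if t = s then ?g t else 0)"
      by (intro sum.cong) auto
    then have "?g s = (\<Sum>t<q. ?g t * (if t = s then 1 else 0))" using s by simp
    then show ?thesis
      unfolding monomial_ideal_def by (intro CollectI exI[of _ "\<lambda>t. if t = s then 1 else 0"]) auto
  qed
  then have "?g ` {..<q} \<subseteq> monomial_ideal" by auto
  then show "x \<in> monomial_ideal" if "x \<in> edge_ideal n (edge ` {..<q})" for x :: "'k poly_nat"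
    using that monomial_ideal_ideal unfolding edge_ideal_def generators genideal_def by blast
  fix x :: "'k poly_nat" assume "x \<in> monomial_ideal"
  then obtain f where f: "\<forall>s<q. f s \<in> polys n" "x = (\<Sum>s<q. ?g s * f s)"
    unfolding monomial_ideal_def by blast
  show "x \<in> edge_ideal n (edge ` {..<q})"
    unfolding edge_ideal_def generators genideal_def
  proof (intro InterI, elim CollectE conjE)
    fix J assume "ideal J (poly_ring n)" and J: "?g ` {..<q} \<subseteq> J"
    then interpret J: ideal J "poly_ring n :: 'k poly_nat ring" by simp
    have "k \<le> q \<Longrightarrow> (\<Sum>s<k. ?g s * f s) \<in> J" for k
    proof (induction k)
      case 0
      then show ?case using additive_subgroup.zero_closed[OF J.additive_subgroup_axioms] by (simp add: poly_ring_simps)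
    next
      case (Suc k)
      then have "k < q" "?g k \<in> J" using J by auto
      then have "?g k * f k \<in> J"
        using J.I_r_closed[of "?g k" "f k"] f(1) by (simp add: poly_ring_simps)
      then show ?case
        using additive_subgroup.a_closed[OF J.additive_subgroup_axioms, of "\<Sum>s<k. ?g s * f s" "?g k * f k"] Suc by (simp add: poly_ring_simps)
    qed
    then show "x \<in> J" unfolding f(2) by blast
  qed
qed

lemma edge_ideal_degree:
  assumes "p \<in> edge_ideal n (edge ` {..<q})" "m \<in> keys p"
  shows "2 \<le> monom_degree m"
proof -
  obtain s where s: "s < q" "monom_dvd (vertex_monom (edge s)) m"
    using assms(1) unfolding edge_ideal_eq by (rule monomial_ideal_keys[OF _ assms(2)])
  then obtain u where "m = vertex_monom (edge s) + u" by (auto simp: monom_dvd_def)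
  then show ?thesis
    using s card_edge finite_edge by (simp add: monom_degree_add monom_degree_vertex_monom)
qed

lemma edge_ideal_const:
  assumes "p \<in> edge_ideal n (edge ` {..<q})"
  shows "lookup p 0 = 0"
  using edge_ideal_degree[OF assms, of 0] by (auto simp: in_keys_iff)

lemma edge_ideal_resolves:
  "resolves n (edge_ideal n (edge ` {..<q}) :: 'k::field poly_nat set) degrees diff_mat"
  unfolding edge_ideal_eq by (rule taylor_resolves)

lemma count_degrees_cover:
  "count_list (degrees i) d = card {S. S \<subseteq> {..<q} \<and> card S = i \<and> int (card (\<Union>(edge ` S))) = d}"
  unfolding count_degrees
  by (intro arg_cong[of _ _ card] Collect_cong) (auto simp: monom_degree_vertex_monom finite_cover)

lemma betti_support:
  assumes "betti n (edge_ideal n (edge ` {..<q}) :: 'k::field poly_nat set) i d \<noteq> 0"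
  shows "int i + 2 \<le> d" "d \<le> 2 * int i + 2" "d \<le> int n"
proof -
  let ?I = "edge_ideal n (edge ` {..<q}) :: 'k poly_nat set"
  show "int i + 2 \<le> d"
  proof (rule ccontr)
    assume "\<not> int i + 2 \<le> d"
    then have "betti n ?I i d = 0"
      by (intro betti_eq_0_below[OF edge_ideal_resolves edge_ideal_const edge_ideal_degree]) auto
    with assms show False by simp
  qed
  have "count_list (degrees (Suc i)) d \<noteq> 0"
    using assms betti_le_count_list[OF edge_ideal_resolves edge_ideal_const, where ?'a = 'k, of i d] by simp
  then have "{S. S \<subseteq> {..<q} \<and> card S = Suc i \<and> int (card (\<Union>(edge ` S))) = d} \<noteq> {}"
    unfolding count_degrees_cover by (metis card.empty)
  then obtain S where S: "S \<subseteq> {..<q}" "card S = Suc i" "d = int (card (\<Union>(edge ` S)))" by blast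
  have "card (\<Union>(edge ` S)) \<le> (\<Sum>s\<in>S. card (edge s))"
    using finite_subset[OF S(1)] by (intro card_UN_le) simp
  also have "\<dots> = (\<Sum>s\<in>S. 2)" using S(1) card_edge by (intro sum.cong) auto
  finally show "d \<le> 2 * int i + 2" using S(2,3) by simp
  have "card (\<Union>(edge ` S)) \<le> card {1..n}"
    using S(1) edge_vertices by (intro card_mono) auto
  then show "d \<le> int n" using S(3) by simp
qed

lemma betti_eq_card_cover:
  assumes "\<And>s. s < q \<Longrightarrow> leaf s \<in> edge s" "\<And>s t. s < q \<Longrightarrow> t < q \<Longrightarrow> s \<noteq> t \<Longrightarrow> leaf s \<notin> edge t"
  shows "betti n (edge_ideal n (edge ` {..<q}) :: 'k::field poly_nat set) i d
    = card {S. S \<subseteq> {..<q} \<and> card S = Suc i \<and> int (card (\<Union>(edge ` S))) = d}"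
proof -
  have cf: "const_free (diff_mat j :: 'k poly_nat mat)" for j
  proof (rule diff_mat_const_free)
    fix S s assume S: "S \<subseteq> {..<q}" "s < q" "s \<notin> S"
    then have "leaf s \<in> \<Union>(edge ` insert s S)" "leaf s \<notin> \<Union>(edge ` S)" using assms by auto
    moreover have "finite (\<Union>(edge ` insert s S))" "finite (\<Union>(edge ` S))"
      using S by (intro finite_cover; auto)+
    ultimately show "vertex_monom (\<Union>(edge ` insert s S)) \<noteq> vertex_monom (\<Union>(edge ` S))"
      by (metis keys_vertex_monom)
  qed
  show ?thesis
    unfolding count_degrees_cover[symmetric]
    by (rule betti_eq_count_list[OF edge_ideal_resolves cf edge_ideal_const])
qed

end

lemma graph_edges_exist:
  assumes "graph_on n E"
  obtains q edge where "graph_edges n q edge" "E = edge ` {..<q}"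
proof -
  have "E \<subseteq> Pow {1..n}" using assms by (auto simp: graph_on_def)
  then have "finite E" by (rule finite_subset) simp
  then obtain edge where "E = edge ` {i::nat. i < card E}"
    using finite_imp_nat_seg_image_inj_on by (metis card_Collect_less_nat card_image)
  then show ?thesis
    using that[of "card E" edge] assms by (auto simp: graph_edges_def lessThan_def)
qed

text \<open>
  A union of a star with centre \<open>1\<close> and single edges. Every edge has a vertex on no other edge, so the
  Taylor resolution is minimal, and its last generator sits in position \<open>(i, d)\<close>, with all others
  below.
\<close>

definition star_edge :: "nat \<Rightarrow> nat \<Rightarrow> nat set" where
  "star_edge j t = (if t < j then {2 * t + 1, 2 * t + 2} else {1, j + t + 1})"

lemma star_edges_cover:
  assumes "1 \<le> j" "j \<le> q"
  shows "\<Union>(star_edge j ` {..<q}) = {1..j + q}"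
proof (intro equalityI subsetI)
  fix v assume "v \<in> \<Union>(star_edge j ` {..<q})"
  then show "v \<in> {1..j + q}" using assms by (auto simp: star_edge_def split: if_splits)
next
  fix v assume v: "v \<in> {1..j + q}"
  \<comment> \<open>The vertices up to 2j are matched in consecutive pairs by the first j edges;
    each later vertex is the outer end of its own edge at the centre.\<close>
  define t where "t = (if v \<le> 2 * j then (v - 1) div 2 else v - j - 1)"
  have "t < q" using v assms by (auto simp: t_def)
  moreover have "v \<in> star_edge j t" using v assms by (auto simp: t_def star_edge_def)
  ultimately show "v \<in> \<Union>(star_edge j ` {..<q})" by blast
qed

lemma star_forest_betti:
  assumes "i + 2 \<le> d" "d \<le> 2 * i + 2" "d \<le> n"
  obtains E where "graph_on n E"
    "betti n (edge_ideal n E :: 'k::field poly_nat set) i (int d) = 1"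
    "\<And>i' d'. betti n (edge_ideal n E :: 'k poly_nat set) i' d' \<noteq> 0 \<Longrightarrow> i' \<le> i \<and> d' \<le> int d"
proof -
  \<comment> \<open>The number of components: j disjoint edges cover 2j vertices and each of the
    other q - j edges adds one, which makes j + q = d. The bounds on d become 1 \<le> j and j \<le>
    q.\<close>
  define j where "j = d - Suc i"
  define q where "q = Suc i"
  define edge where "edge = star_edge j"
  have j: "1 \<le> j" "j \<le> q" "j + q = d" using assms by (auto simp: j_def q_def)
  have cover: "\<Union>(edge ` {..<q}) = {1..d}"
    unfolding edge_def using star_edges_cover[OF j(1,2)] j(3) by simp
  interpret graph_edges n q edge
  proof
    have "edge s \<subseteq> {1..n}" if "s < q" for s
    proof -
      have "edge s \<subseteq> \<Union>(edge ` {..<q})" using that by blast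
      also have "\<dots> \<subseteq> {1..n}" unfolding cover using assms(3) by simp
      finally show ?thesis .
    qed
    moreover have "card (edge s) = 2" for s
      using j(1) by (auto simp: edge_def star_edge_def card_insert_if)
    ultimately show "graph_on n (edge ` {..<q})" by (auto simp: graph_on_def)
  qed
  \<comment> \<open>The end of each edge that lies on no other; for the edge {1,2} this must be 2,
    since 1 is the centre.\<close>
  define leaf where "leaf t = (if t < j then 2 * t + 2 else j + t + 1)" for t
  have leaf: "leaf s \<in> edge s" for s by (simp add: leaf_def edge_def star_edge_def)
  have not_leaf: "leaf s \<notin> edge t" if "s \<noteq> t" for s t
    using that j(1) by (auto simp: leaf_def edge_def star_edge_def split: if_splits)
  have b: "betti n (edge_ideal n (edge ` {..<q}) :: 'k poly_nat set) i' d'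
      = card {S. S \<subseteq> {..<q} \<and> card S = Suc i' \<and> int (card (\<Union>(edge ` S))) = d'}" for i' d'
    by (rule betti_eq_card_cover[of leaf]) (use leaf not_leaf in auto)
  show ?thesis
  proof
    show "graph_on n (edge ` {..<q})" by (rule graph)
    have "{S. S \<subseteq> {..<q} \<and> card S = Suc i \<and> int (card (\<Union>(edge ` S))) = int d} = {{..<q}}"
    proof (intro equalityI subsetI)
      fix S assume "S \<in> {S. S \<subseteq> {..<q} \<and> card S = Suc i \<and> int (card (\<Union>(edge ` S))) = int d}"
      then have "S = {..<q}" by (intro card_subset_eq) (auto simp: q_def)
      then show "S \<in> {{..<q}}" by simp
    next
      fix S assume "S \<in> {{..<q}}"
      then show "S \<in> {S. S \<subseteq> {..<q} \<and> card S = Suc i \<and> int (card (\<Union>(edge ` S))) = int d}"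
        using cover by (simp add: q_def)
    qed
    then show "betti n (edge_ideal n (edge ` {..<q}) :: 'k poly_nat set) i (int d) = 1"
      unfolding b by simp
    fix i' d' assume "betti n (edge_ideal n (edge ` {..<q}) :: 'k poly_nat set) i' d' \<noteq> 0"
    then have "{S. S \<subseteq> {..<q} \<and> card S = Suc i' \<and> int (card (\<Union>(edge ` S))) = d'} \<noteq> {}"
      unfolding b by (metis card.empty)
    then obtain S where S: "S \<subseteq> {..<q}" "card S = Suc i'" "d' = int (card (\<Union>(edge ` S)))" by blast
    have "Suc i' \<le> q" using card_mono[OF _ S(1)] S(2) by simp
    moreover have "card (\<Union>(edge ` S)) \<le> card {1..d}"
      using S(1) cover by (intro card_mono) auto
    ultimately show "i' \<le> i \<and> d' \<le> int d" using S(3) by (simp add: q_def)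
  qed
qed

subsection \<open>The dimension of the cone\<close>

lemma sum_fun_apply: "(\<Sum>a\<in>A. f a) x = (\<Sum>a\<in>A. f a x)" for f :: "'a \<Rightarrow> 'b \<Rightarrow> 'c::comm_monoid_add"
  by (induction A rule: infinite_finite_induct) (auto simp: zero_fun_def)

section \<open>The possible positions of non-zero Betti numbers and their count\<close>

definition positions :: "nat \<Rightarrow> (nat \<times> int) set" where
  "positions n = {(i, d). int i + 2 \<le> d \<and> d \<le> 2 * int i + 2 \<and> d \<le> int n}"

text \<open>For fixed d, the index i runs from the upper half of d minus 1, written
  \<open>d - d div 2 - 1\<close>, up to d - 2, which makes \<open>d div 2\<close> values. Truncated
  subtraction leaves the interval empty for d \<le> 1, as required.\<close>

lemma positions_eq_image:
  "positions n = (\<lambda>(d, i). (i, int d)) ` (SIGMA d:{..n}. {d - d div 2 - 1..<d - 1})"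
proof (intro equalityI subsetI)
  fix x assume "x \<in> positions n"
  then obtain i d where x: "x = (i, d)" "int i + 2 \<le> d" "d \<le> 2 * int i + 2" "d \<le> int n"
    by (auto simp: positions_def)
  then have "x = (i, int (nat d))" "(nat d, i) \<in> (SIGMA d:{..n}. {d - d div 2 - 1..<d - 1})"
    by auto
  then show "x \<in> (\<lambda>(d, i). (i, int d)) ` (SIGMA d:{..n}. {d - d div 2 - 1..<d - 1})"
    by (metis (no_types, lifting) case_prod_conv image_eqI)
next
  fix x assume "x \<in> (\<lambda>(d, i). (i, int d)) ` (SIGMA d:{..n}. {d - d div 2 - 1..<d - 1})"
  then obtain d i where "x = (i, int d)" "d \<le> n" "d - d div 2 - 1 \<le> i" "i < d - 1" by auto
  then show "x \<in> positions n" by (auto simp: positions_def)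
qed

lemma finite_positions: "finite (positions n)"
  unfolding positions_eq_image by auto

lemma card_positions: "card (positions n) = (\<Sum>d\<le>n. d div 2)"
proof -
  have "inj_on (\<lambda>(d, i). (i, int d)) A" for A :: "(nat \<times> nat) set"
    by (auto simp: inj_on_def)
  then have "card (positions n) = card (SIGMA d:{..n}. {d - d div 2 - 1..<d - 1})"
    unfolding positions_eq_image by (rule card_image)
  also have "\<dots> = (\<Sum>d\<le>n. card {d - d div 2 - 1..<d - 1})"
    by (rule card_SigmaI) auto
  also have "\<dots> = (\<Sum>d\<le>n. d div 2)"
    by (intro sum.cong) auto
  finally show ?thesis .
qed

text \<open>The terms for 2r+1 and 2r+2 are r and r+1; together they bridge the gap 2r+1 between
  consecutive squares.\<close>

lemma sum_div_2_even: "(\<Sum>d\<le>2 * r. d div 2) = r\<^sup>2" for r :: nat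
  by (induction r) (auto simp: power2_eq_square)

section \<open>Coordinate vectors and linear spans of diagrams\<close>

definition unit_diagram :: "nat \<times> int \<Rightarrow> diagram" where
  "unit_diagram p = (\<lambda>x. if x = p then 1 else 0)"

lemma unit_diagram_expansion:
  assumes "finite P" "\<And>x. x \<notin> P \<Longrightarrow> v x = 0"
  shows "v = (\<Sum>p\<in>P. diagram_scale (v p) (unit_diagram p))"
proof
  fix x
  have "(\<Sum>p\<in>P. diagram_scale (v p) (unit_diagram p)) x = (\<Sum>p\<in>P. if p = x then v p else 0)"
    unfolding sum_fun_apply by (intro sum.cong) (auto simp: diagram_scale_def unit_diagram_def)
  then show "v x = (\<Sum>p\<in>P. diagram_scale (v p) (unit_diagram p)) x"
    using assms by (cases "x \<in> P") auto
qed

lemma unit_diagram_independent: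
  assumes "finite P"
  shows "diagram.independent (unit_diagram ` P)" "card (unit_diagram ` P) = card P"
proof -
  have inj: "inj_on unit_diagram P"
    by (rule inj_onI) (metis unit_diagram_def zero_neq_one)
  show "card (unit_diagram ` P) = card P" by (rule card_image[OF inj])
  show "diagram.independent (unit_diagram ` P)"
  proof (rule diagram.independent_if_scalars_zero)
    fix f u assume f: "(\<Sum>x\<in>unit_diagram ` P. diagram_scale (f x) x) = 0" and "u \<in> unit_diagram ` P"
    then obtain p where p: "p \<in> P" "u = unit_diagram p" by blast
    have "0 = (\<Sum>x\<in>unit_diagram ` P. diagram_scale (f x) x) p"
      unfolding f by simp
    also have "\<dots> = (\<Sum>x\<in>P. if x = p then f (unit_diagram x) else 0)"
      unfolding sum.reindex[OF inj] sum_fun_apply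
      by (intro sum.cong) (auto simp: diagram_scale_def unit_diagram_def)
    also have "\<dots> = f u" using p assms by simp
    finally show "f u = 0" by simp
  qed (use assms in simp)
qed

lemma span_generated_cone: "diagram.span (generated_cone S) = diagram.span S"
proof (intro equalityI)
  have "(\<Sum>v\<in>T. diagram_scale (c v) v) \<in> diagram.span S" if "T \<subseteq> S" for T c
    using that by (intro diagram.span_sum diagram.span_scale diagram.span_base) blast
  then have "generated_cone S \<subseteq> diagram.span S"
    unfolding generated_cone_def by blast
  then show "diagram.span (generated_cone S) \<subseteq> diagram.span S"
    by (rule diagram.span_minimal[OF _ diagram.subspace_span])
  have "v \<in> generated_cone S" if "v \<in> S" for v
    unfolding generated_cone_def
    using that by (intro CollectI exI[of _ "{v}"] exI[of _ "\<lambda>_. 1"]) (auto simp: diagram_scale_def)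
  then show "diagram.span S \<subseteq> diagram.span (generated_cone S)"
    by (intro diagram.span_mono) auto
qed

lemma betti_diagram_support:
  assumes "graph_on n E" "betti_diagram n (edge_ideal n E :: 'k::field poly_nat set) x \<noteq> 0"
  shows "x \<in> positions n"
proof -
  obtain i d where x: "x = (i, d)" by (cases x)
  obtain q edge where "graph_edges n q edge" and E: "E = edge ` {..<q}"
    by (rule graph_edges_exist[OF assms(1)])
  interpret graph_edges n q edge by fact
  have "betti n (edge_ideal n (edge ` {..<q}) :: 'k poly_nat set) i d \<noteq> 0"
    using assms(2) unfolding x E betti_diagram_def by (auto split: if_splits)
  from betti_support[OF this] show ?thesis by (simp add: x positions_def)
qed

lemma span_betti_cone:
  "diagram.span (betti_cone TYPE('k::field) n) = diagram.span (unit_diagram ` positions n)"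
proof -
  let ?\<beta> = "\<lambda>E. betti_diagram n (edge_ideal n E :: 'k poly_nat set)"
  let ?S = "{?\<beta> E | E. graph_on n E}"
  have "unit_diagram (i, d) \<in> diagram.span ?S" if "(i, d) \<in> positions n" for i d
    using that
  \<comment> \<open>The other entries of the chosen diagram are at positions below (i,d) in both
    coordinates and different from it, so their sum of coordinates is smaller. Degrees of positions
    are at least 2, hence \<open>nat\<close> loses nothing.\<close>
  proof (induction "i + nat d" arbitrary: i d rule: less_induct)
    case less
    have id: "i + 2 \<le> nat d" "nat d \<le> 2 * i + 2" "nat d \<le> n" "int (nat d) = d"
      using less.prems by (auto simp: positions_def)
    obtain E where E: "graph_on n E" "betti n (edge_ideal n E :: 'k poly_nat set) i d = 1"
      "\<And>i' d'. betti n (edge_ideal n E :: 'k poly_nat set) i' d' \<noteq> 0 \<Longrightarrow> i' \<le> i \<and> d' \<le> d"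
      using star_forest_betti[OF id(1-3), where ?'k = 'k] unfolding id(4) by blast
    \<comment> \<open>The truncation at i \<le> n in \<open>betti_diagram\<close> spares this entry,
      because i + 2 \<le> d \<le> n.\<close>
    have top: "?\<beta> E (i, d) = 1" using E(2) id by (simp add: betti_diagram_def)
    have "?\<beta> E = (\<Sum>p\<in>positions n. diagram_scale (?\<beta> E p) (unit_diagram p))"
      using betti_diagram_support[OF E(1)] by (intro unit_diagram_expansion finite_positions) blast
    also have "\<dots> = unit_diagram (i, d)
        + (\<Sum>p\<in>positions n - {(i, d)}. diagram_scale (?\<beta> E p) (unit_diagram p))"
      using less.prems top by (subst sum.remove[of _ "(i, d)"]) (auto simp: finite_positions)
    finally have "unit_diagram (i, d)
        = ?\<beta> E - (\<Sum>p\<in>positions n - {(i, d)}. diagram_scale (?\<beta> E p) (unit_diagram p))"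
      by (simp add: eq_diff_eq)
    moreover have "diagram_scale (?\<beta> E p) (unit_diagram p) \<in> diagram.span ?S"
      if p: "p \<in> positions n - {(i, d)}" for p
    proof (cases "?\<beta> E p = 0")
      case True
      then show ?thesis using diagram.span_zero by simp
    next
      case False
      obtain i' d' where p': "p = (i', d')" by (cases p)
      have "betti n (edge_ideal n E :: 'k poly_nat set) i' d' \<noteq> 0"
        using False unfolding p' betti_diagram_def by (auto split: if_splits)
      then have "i' \<le> i \<and> d' \<le> d" by (rule E(3))
      moreover have "0 \<le> d'" "p \<noteq> (i, d)" using p by (auto simp: p' positions_def)
      ultimately have "i' + nat d' < i + nat d" unfolding p' by auto
      then have "unit_diagram p \<in> diagram.span ?S"
        unfolding p' using p p' by (intro less.hyps) auto
      then show ?thesis by (rule diagram.span_scale)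
    qed
    moreover have "?\<beta> E \<in> diagram.span ?S"
      using E(1) by (intro diagram.span_base) blast
    ultimately show ?case by (auto intro!: diagram.span_diff diagram.span_sum)
  qed
  then have "unit_diagram ` positions n \<subseteq> diagram.span ?S" by auto
  moreover have "?S \<subseteq> diagram.span (unit_diagram ` positions n)"
  proof
    fix v assume "v \<in> ?S"
    then obtain E where E: "graph_on n E" "v = ?\<beta> E" by blast
    have "v = (\<Sum>p\<in>positions n. diagram_scale (v p) (unit_diagram p))"
      unfolding E(2) using betti_diagram_support[OF E(1)]
      by (intro unit_diagram_expansion finite_positions) blast
    also have "\<dots> \<in> diagram.span (unit_diagram ` positions n)"
      by (intro diagram.span_sum diagram.span_scale diagram.span_base) auto
    finally show "v \<in> diagram.span (unit_diagram ` positions n)" .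
  qed
  ultimately show ?thesis
    unfolding betti_cone_def span_generated_cone diagram.span_eq by (intro conjI)
qed

lemma cone_dim_betti_cone: "cone_dim (betti_cone TYPE('k::field) n) = (\<Sum>d\<le>n. d div 2)"
proof -
  note ind = unit_diagram_independent[OF finite_positions[of n]]
  have "diagram.dim (diagram.span (unit_diagram ` positions n)) = card (unit_diagram ` positions n)"
    by (rule diagram.dim_eq_card[OF _ ind(1)]) (simp add: diagram.span_span)
  then show ?thesis
    unfolding cone_dim_def span_betti_cone using ind(2) card_positions by simp
qed

theorem theorem1p2:
  fixes n :: nat
  shows "(\<forall>r. n = 2 * r \<longrightarrow> cone_dim (betti_cone TYPE('k::field) n) = r\<^sup>2) \<and>
         (\<forall>r. n = 2 * r + 1 \<longrightarrow> cone_dim (betti_cone TYPE('k) n) = r\<^sup>2 + r)"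
  \<comment> \<open>The odd case has one more summand, (2r+1) div 2 = r.\<close>
  unfolding cone_dim_betti_cone using sum_div_2_even by auto

end
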